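(* Let $N\ge1$, $K\ge 1$. Let $(M_n)_{n\ge0}$ be an increasing sequence of positive real numbers with $M_0=1$, which satisfies (mg) and $(\star)$. Let $m_0,m_1,\dots,m_N$ be $(M_n)$-sequences of orders $s_0,s_1,\dots,s_N\ge0$, respectively, and assume additionally that $s_1,\dots,s_N$ are (non-negative) rational numbers. Put $\boldsymbol{m}=(m_1,\dots,m_N)$, $\boldsymbol{s}=(s_1,\dots,s_N)$, and $$P(\partial_{m_0,t},\partial_{\boldsymbol{m},\boldsymbol{z}})=\partial_{m_0,t}^{K}-\sum_{(j,\boldsymbol{\alpha})\in\Lambda}a_{j,\boldsymbol{\alpha}}\,\partial_{m_0,t}^{j}\partial_{\boldsymbol{m},\boldsymbol{z}}^{\boldsymbol{\alpha}},$$ where $\Lambda\subseteq\{0,\dots,K-1\}\times\mathbb{N}_0^N$ is a finite set and $a_{j,\boldsymbol{\alpha}}\in\mathbb{C}$ are constants. Let $k_1$ be the first positive slope of the Newton polygon associated with $P$, and assume $1/k_1>0$. Let $\hat f(t,\boldsymbol{z})$ be a formal power series of $(M_n)$-order $1/k_1$. Then the formal solution $\hat u(t,\boldsymbol{z})$ of the Cauchy problem $$P(\partial_{m_0,t},\partial_{\boldsymbol{m},\boldsymbol{z}})u(t,\boldsymbol{z})=\hat f(t,\boldsymbol{z}),\qquad \partial_{m_0,t}^ju(0,\boldsymbol{z})=0,\quad j=0,\dots,K-1,$$ is of $(M_n)$-order $1/k_1$.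
   Context: Here $t\in\mathbb{C}$, $\boldsymbol{z}=(z_1,\dots,z_N)\in\mathbb{C}^N$; $\mathbb{N}_0=\{0,1,2,\dots\}$; $D_R^N=\{\boldsymbol{z}\in\mathbb{C}^N:|z_j|<R,\ j=1,\dots,N\}$; $\mathcal{O}(D_R^N)$ is the set of holomorphic functions on $D_R^N$; $\boldsymbol{s}\cdot\boldsymbol{\alpha}=s_1\alpha_1+\dots+s_N\alpha_N$. A sequence $(M_n)_{n\ge 0}$ of positive reals with $M_0=1$ satisfies (mg) if there is $B>0$ with $M_{n+k}\le B^{n+k}M_nM_k$ for all $n,k\ge0$; it satisfies $(\star)$ if there is $b>0$ with $M_{n+k}\ge b^{n+k}M_nM_k$ for all $n,k\ge0$. A sequence of positive reals $(m(n))_{n\ge0}$ is an $(M_n)$-sequence of order $s\in\mathbb{R}$ if there are $\mathfrak{a},\mathfrak{A}>0$ with $\mathfrak{a}^n(M_n)^s\le m(n)\le\mathfrak{A}^n(M_n)^s$ for all $n\ge0$. For a sequence $m=(m(n))_{n\ge0}$ of positive reals, the $m$-differential operator is the operator on formal power series in $z$ given by $\partial_{m,z}\left(\sum_{n\ge0}\frac{u_n}{m(n)}z^n\right)=\sum_{n\ge0}\frac{u_{n+1}}{m(n)}z^n$; it acts with the other variables as parameters (coefficientwise). For $\boldsymbol{\alpha}\in\mathbb{N}_0^N$, $\partial_{\boldsymbol{m},\boldsymbol{z}}^{\boldsymbol{\alpha}}=\partial_{m_1,z_1}^{\alpha_1}\cdots\partial_{m_N,z_N}^{\alpha_N}$.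 A formal power series $\hat g(t,\boldsymbol{z})=\sum_{n\ge0}g_n(\boldsymbol{z})t^n$ is of $(M_n)$-order $s$ if, for some $R>0$, all $g_n\in\mathcal{O}(D_R^N)$ and for every $r\in(0,R)$ there are $A,B>0$ with $|g_n(\boldsymbol{z})|\le AB^n(M_n)^s$ for all $\boldsymbol{z}\in D_r^N$ and $n\ge0$. (The radius $R$ may differ between $\hat f$ and $\hat u$.) Newton polygon: the convex hull of $\Delta(Ks_0,-K)\cup\bigcup_{(j,\boldsymbol{\alpha})\in\Lambda,\,a_{j,\boldsymbol{\alpha}}\ne0}\Delta(js_0+\boldsymbol{\alpha}\cdot\boldsymbol{s},-j)$, where $\Delta(a,b)=\{(x,y)\in\mathbb{R}^2:x\le a,\ y\ge b\}$; its first positive slope $k_1$ is determined by $$\frac1{k_1}=\max\left\{0,\max_{(j,\boldsymbol{\alpha})\in\Lambda,\ a_{j,\boldsymbol{\alpha}}\neq0}\frac{s_0(j-K)+\boldsymbol{s}\cdot\boldsymbol{\alpha}}{K-j}\right\}.$$ The formal solution is the formal power series in $t$ (with coefficients power series in $\boldsymbol{z}$) satisfying the equation and initial conditions formally. *)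

theory Defs
  imports "HOL-Analysis.Analysis"
begin

section \<open>Sequences\<close>

definition moderate_growth :: "(nat \<Rightarrow> real) \<Rightarrow> bool" where
  "moderate_growth M \<longleftrightarrow> (\<exists>B>0. \<forall>n k. M (n + k) \<le> B ^ (n + k) * M n * M k)"

definition star_condition :: "(nat \<Rightarrow> real) \<Rightarrow> bool" where
  "star_condition M \<longleftrightarrow> (\<exists>b>0. \<forall>n k. M (n + k) \<ge> b ^ (n + k) * M n * M k)"

definition is_seq_of_order :: "(nat \<Rightarrow> real) \<Rightarrow> real \<Rightarrow> (nat \<Rightarrow> real) \<Rightarrow> bool" where
  "is_seq_of_order M s m \<longleftrightarrow> (\<forall>n. 0 < m n) \<and>
     (\<exists>a>0. \<exists>A>0. \<forall>n. a ^ n * M n powr s \<le> m n \<and> m n \<le> A ^ n * M n powr s)"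


section \<open>Formal power series and \<open>m\<close>-differential operators\<close>

text \<open>
  The finite type \<open>'n\<close> indexes the variables \<open>z\<^sub>1, \<dots>, z\<^sub>N\<close>, so \<open>N = CARD('n)\<close>. A formal power
  series in \<open>z\<close> is its family of coefficients; a formal power series in \<open>t\<close> and \<open>z\<close> is
  the sequence of its \<open>t\<close>-coefficients, each a formal power series in \<open>z\<close>.
\<close>

type_synonym 'n z_series = "('n \<Rightarrow> nat) \<Rightarrow> complex"
type_synonym 'n tz_series = "nat \<Rightarrow> 'n z_series"

text \<open>
  The operator maps \<open>\<Sum> u\<^sub>n / m(n) z\<^sup>n\<close> to \<open>\<Sum> u\<^sub>n\<^sub>+\<^sub>1 / m(n) z\<^sup>n\<close>; in terms of the
  plain coefficients \<open>c\<^sub>n = u\<^sub>n / m(n)\<close> the result has coefficients \<open>m(n+1) c\<^sub>n\<^sub>+\<^sub>1 / m(n)\<close>.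
\<close>

definition mdiff_z :: "(nat \<Rightarrow> real) \<Rightarrow> 'n \<Rightarrow> 'n z_series \<Rightarrow> 'n z_series" where
  "mdiff_z m i c = (\<lambda>\<beta>. of_real (m (Suc (\<beta> i))) * c (\<beta>(i := Suc (\<beta> i))) / of_real (m (\<beta> i)))"

definition mdiff_t :: "(nat \<Rightarrow> real) \<Rightarrow> 'n tz_series \<Rightarrow> 'n tz_series" where
  "mdiff_t m u = (\<lambda>n \<beta>. of_real (m (Suc n)) * u (Suc n) \<beta> / of_real (m n))"

text \<open>
  Composition of the operators \<open>mdiff_z (m i) i ^^ \<alpha> i\<close> over all variables; they commute, so
  the fold over the unordered index set is well defined (see \<open>mdiff_z_multi_eq\<close>).
\<close>

definition mdiff_z_multi ::
  "('n::finite \<Rightarrow> nat \<Rightarrow> real) \<Rightarrow> ('n \<Rightarrow> nat) \<Rightarrow> 'n z_series \<Rightarrow> 'n z_series" where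
  "mdiff_z_multi m \<alpha> c = Finite_Set.fold (\<lambda>i. mdiff_z (m i) i ^^ \<alpha> i) c UNIV"

lemma mdiff_z_commute:
  "mdiff_z (m i) i \<circ> mdiff_z (m j) j = mdiff_z (m j) j \<circ> mdiff_z (m i) i"
  by (cases "i = j") (auto simp: fun_eq_iff mdiff_z_def fun_upd_twist mult_ac)

lemma mdiff_z_funpow_commute:
  "(mdiff_z (m i) i ^^ k) \<circ> (mdiff_z (m j) j ^^ l) = (mdiff_z (m j) j ^^ l) \<circ> (mdiff_z (m i) i ^^ k)"
proof -
  have *: "f \<circ> (g ^^ p) = (g ^^ p) \<circ> f" if "f \<circ> g = g \<circ> f" for f g :: "'b \<Rightarrow> 'b" and p
  proof (induction p)
    case (Suc p)
    have "f \<circ> (g ^^ Suc p) = (f \<circ> g) \<circ> (g ^^ p)" by (simp add: o_assoc)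
    also have "\<dots> = g \<circ> (f \<circ> (g ^^ p))" by (simp add: that o_assoc)
    also have "\<dots> = (g ^^ Suc p) \<circ> f" unfolding Suc by (simp add: o_assoc)
    finally show ?case .
  qed simp
  show ?thesis by (rule *[OF *[OF mdiff_z_commute, symmetric], symmetric])
qed

lemma comp_fun_commute_mdiff_z: "comp_fun_commute (\<lambda>i. mdiff_z (m i) i ^^ \<alpha> i)"
  by standard (rule mdiff_z_funpow_commute)

lemma mdiff_z_funpow:
  assumes "\<And>n. m n \<noteq> 0"
  shows "(mdiff_z m i ^^ k) c =
    (\<lambda>\<beta>. of_real (m (\<beta> i + k)) * c (\<beta>(i := \<beta> i + k)) / of_real (m (\<beta> i)))"
  using assms by (induction k) (auto simp: fun_eq_iff mdiff_z_def)

lemma mdiff_z_multi_eq: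
  fixes m :: "'n::finite \<Rightarrow> nat \<Rightarrow> real"
  assumes "\<And>i n. m i n \<noteq> 0"
  shows "mdiff_z_multi m \<alpha> c =
    (\<lambda>\<beta>. of_real (\<Prod>i\<in>UNIV. m i (\<beta> i + \<alpha> i) / m i (\<beta> i)) * c (\<lambda>i. \<beta> i + \<alpha> i))"
proof -
  interpret comp_fun_commute "\<lambda>i. mdiff_z (m i) i ^^ \<alpha> i"
    by (rule comp_fun_commute_mdiff_z)
  have "Finite_Set.fold (\<lambda>i. mdiff_z (m i) i ^^ \<alpha> i) c S =
    (\<lambda>\<beta>. of_real (\<Prod>i\<in>S. m i (\<beta> i + \<alpha> i) / m i (\<beta> i)) *
      c (\<lambda>i. if i \<in> S then \<beta> i + \<alpha> i else \<beta> i))" for S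
    using finite[of S]
  proof (induction S rule: finite_induct)
    case (insert j S)
    have 1: "(\<Prod>i\<in>S. m i ((\<beta>(j := x)) i + \<alpha> i) / m i ((\<beta>(j := x)) i)) =
      (\<Prod>i\<in>S. m i (\<beta> i + \<alpha> i) / m i (\<beta> i))" for \<beta> x
      using insert.hyps by (intro prod.cong) auto
    have 2: "(\<lambda>i. if i \<in> S then (\<beta>(j := \<beta> j + \<alpha> j)) i + \<alpha> i else (\<beta>(j := \<beta> j + \<alpha> j)) i) =
      (\<lambda>i. if i \<in> insert j S then \<beta> i + \<alpha> i else \<beta> i)" for \<beta>
      using insert.hyps by (auto simp: fun_eq_iff)
    show ?case
      unfolding fold_insert[OF insert.hyps] insert.IH
      unfolding mdiff_z_funpow[OF assms] 1 2
      using insert.hyps by (simp add: mult_ac)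
  qed simp
  then show ?thesis by (simp add: mdiff_z_multi_def)
qed


section \<open>The Cauchy problem\<close>

definition cauchy_operator ::
  "nat \<Rightarrow> (nat \<times> ('n::finite \<Rightarrow> nat)) set \<Rightarrow> (nat \<Rightarrow> ('n \<Rightarrow> nat) \<Rightarrow> complex) \<Rightarrow>
   (nat \<Rightarrow> real) \<Rightarrow> ('n \<Rightarrow> nat \<Rightarrow> real) \<Rightarrow> 'n tz_series \<Rightarrow> 'n tz_series" where
  "cauchy_operator K \<Lambda> a m0 m u = (\<lambda>n \<beta>. (mdiff_t m0 ^^ K) u n \<beta> -
     (\<Sum>(j, \<alpha>)\<in>\<Lambda>. a j \<alpha> * (mdiff_t m0 ^^ j) (\<lambda>k. mdiff_z_multi m \<alpha> (u k)) n \<beta>))"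

definition formal_solution ::
  "nat \<Rightarrow> (nat \<times> ('n::finite \<Rightarrow> nat)) set \<Rightarrow> (nat \<Rightarrow> ('n \<Rightarrow> nat) \<Rightarrow> complex) \<Rightarrow>
   (nat \<Rightarrow> real) \<Rightarrow> ('n \<Rightarrow> nat \<Rightarrow> real) \<Rightarrow> 'n tz_series \<Rightarrow> 'n tz_series \<Rightarrow> bool" where
  "formal_solution K \<Lambda> a m0 m f u \<longleftrightarrow>
     cauchy_operator K \<Lambda> a m0 m u = f \<and> (\<forall>j<K. (mdiff_t m0 ^^ j) u 0 = (\<lambda>\<beta>. 0))"

lemma mdiff_t_funpow:
  assumes "\<And>n. m n \<noteq> 0"
  shows "(mdiff_t m ^^ k) u = (\<lambda>n \<beta>. of_real (m (n + k)) * u (n + k) \<beta> / of_real (m n))"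
  using assms by (induction k) (auto simp: fun_eq_iff mdiff_t_def)

lemma formal_solution_iff:
  fixes m :: "'n::finite \<Rightarrow> nat \<Rightarrow> real"
  assumes "\<And>n. m0 n \<noteq> 0"
  shows "formal_solution K \<Lambda> a m0 m f u \<longleftrightarrow>
    (\<forall>n. u n = (if n < K then (\<lambda>\<beta>. 0) else (\<lambda>\<beta>. of_real (m0 (n - K)) / of_real (m0 n) *
      (f (n - K) \<beta> + (\<Sum>(j, \<alpha>)\<in>\<Lambda>. a j \<alpha> * (of_real (m0 (n - K + j)) *
        mdiff_z_multi m \<alpha> (u (n - K + j)) \<beta> / of_real (m0 (n - K))))))))"
    (is "_ \<longleftrightarrow> (\<forall>n. u n = ?R n)")
proof -
  let ?S = "\<lambda>n \<beta>. \<Sum>(j, \<alpha>)\<in>\<Lambda>. a j \<alpha> * (of_real (m0 (n + j)) *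
        mdiff_z_multi m \<alpha> (u (n + j)) \<beta> / of_real (m0 n))"
  define R where "R = ?R"
  have init: "(\<forall>j<K. (mdiff_t m0 ^^ j) u 0 = (\<lambda>\<beta>. 0)) \<longleftrightarrow> (\<forall>n<K. u n = R n)"
    using assms by (simp add: R_def mdiff_t_funpow fun_eq_iff)
  have "cauchy_operator K \<Lambda> a m0 m u = f \<longleftrightarrow>
    (\<forall>n \<beta>. of_real (m0 (n + K)) * u (n + K) \<beta> / of_real (m0 n) - ?S n \<beta> = f n \<beta>)"
    using assms by (simp add: cauchy_operator_def mdiff_t_funpow fun_eq_iff)
  also have "\<dots> \<longleftrightarrow> (\<forall>n \<beta>. u (n + K) \<beta> = R (n + K) \<beta>)"
  proof (intro all_cong1)
    fix n \<beta>
    have *: "p * x / q - y = z \<longleftrightarrow> x = q / p * (z + y)" if "p \<noteq> 0" "q \<noteq> 0" for p q x y z :: complex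
      using that by (auto simp: field_simps)
    have nz: "complex_of_real (m0 k) \<noteq> 0" for k using assms by simp
    have R: "R (n + K) \<beta> = of_real (m0 n) / of_real (m0 (n + K)) * (f n \<beta> + ?S n \<beta>)"
      unfolding R_def by simp
    show "of_real (m0 (n + K)) * u (n + K) \<beta> / of_real (m0 n) - ?S n \<beta> = f n \<beta> \<longleftrightarrow>
      u (n + K) \<beta> = R (n + K) \<beta>"
      unfolding R by (rule *[OF nz nz])
  qed
  also have "\<dots> \<longleftrightarrow> (\<forall>n. u (n + K) = R (n + K))"
    by (simp add: fun_eq_iff)
  also have "\<dots> \<longleftrightarrow> (\<forall>n\<ge>K. u n = R n)"
    by (metis le_add2 le_add_diff_inverse2)
  finally have "formal_solution K \<Lambda> a m0 m f u \<longleftrightarrow> (\<forall>n. u n = R n)"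
    unfolding formal_solution_def init by (meson not_less)
  then show ?thesis unfolding R_def .
qed

lemma formal_solution_ex1:
  fixes m :: "'n::finite \<Rightarrow> nat \<Rightarrow> real"
  assumes m0: "\<And>n. m0 n \<noteq> 0" and \<Lambda>: "\<And>j \<alpha>. (j, \<alpha>) \<in> \<Lambda> \<Longrightarrow> j < K"
  shows "\<exists>!u. formal_solution K \<Lambda> a m0 m f u"
proof -
  define F where "F u n = (if n < K then (\<lambda>\<beta>. 0) else (\<lambda>\<beta>. of_real (m0 (n - K)) / of_real (m0 n) *
      (f (n - K) \<beta> + (\<Sum>(j, \<alpha>)\<in>\<Lambda>. a j \<alpha> * (of_real (m0 (n - K + j)) *
        mdiff_z_multi m \<alpha> (u (n - K + j)) \<beta> / of_real (m0 (n - K)))))))"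
    for u :: "'n tz_series" and n
  have F_cong: "F u n = F v n" if "\<And>k. k < n \<Longrightarrow> u k = v k" for u v n
  proof (cases "n < K")
    case False
    then have "n - K + j < n" if "(j, \<alpha>) \<in> \<Lambda>" for j \<alpha> using \<Lambda>[OF that] by simp
    with that have "u (n - K + j) = v (n - K + j)" if "(j, \<alpha>) \<in> \<Lambda>" for j \<alpha>
      using \<open>(j, \<alpha>) \<in> \<Lambda>\<close> by blast
    then show ?thesis using False
      by (auto simp: F_def intro!: ext sum.cong arg_cong2[where f = "(+)"] arg_cong2[where f = "(*)"])
  qed (simp add: F_def)
  have sol: "formal_solution K \<Lambda> a m0 m f u \<longleftrightarrow> (\<forall>n. u n = F u n)" for u
    unfolding formal_solution_iff[of m0, OF m0] F_def ..
  have "adm_wf less_than F"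
    by (auto simp: adm_wf_def intro: F_cong)
  from wfrec_fixpoint[OF wf_less_than this]
  have ex: "wfrec less_than F n = F (wfrec less_than F) n" for n
    by (rule fun_cong)
  have uniq: "u n = v n" if "\<forall>n. u n = F u n" "\<forall>n. v n = F v n" for u v n
  proof (induction n rule: less_induct)
    case (less n)
    show ?case
      unfolding spec[OF that(1), of n] spec[OF that(2), of n] by (rule F_cong) (rule less)
  qed
  show ?thesis unfolding sol
  proof (rule ex1I)
    show "\<forall>n. wfrec less_than F n = F (wfrec less_than F) n" using ex by blast
    show "u = wfrec less_than F" if "\<forall>n. u n = F u n" for u
      by (rule ext) (rule uniq[OF that], use ex in blast)
  qed
qed


section \<open>Series of given order\<close>

definition polydisc :: "real \<Rightarrow> (complex ^ 'n) set" where
  "polydisc R = {z. \<forall>i. cmod (z $ i) < R}"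

text \<open>Holomorphy in several variables: complex Frechet differentiability at every point.\<close>

definition multi_holomorphic_on :: "(complex ^ 'n::finite \<Rightarrow> complex) \<Rightarrow> (complex ^ 'n) set \<Rightarrow> bool" where
  "multi_holomorphic_on g S \<longleftrightarrow>
     (\<forall>z\<in>S. \<exists>D. (g has_derivative D) (at z) \<and> (\<forall>c v. D (c *s v) = c * D v))"

definition represents_on :: "'n::finite z_series \<Rightarrow> (complex ^ 'n \<Rightarrow> complex) \<Rightarrow> (complex ^ 'n) set \<Rightarrow> bool" where
  "represents_on c g S \<longleftrightarrow>
     (\<forall>z\<in>S. ((\<lambda>\<alpha>. c \<alpha> * (\<Prod>i\<in>UNIV. (z $ i) ^ \<alpha> i)) has_sum g z) UNIV)"

text \<open>
  A formal coefficient in \<open>z\<close> lies in \<open>\<O>(D\<^sub>R)\<close> when it is the power series, convergent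
  on the whole polydisc, of a holomorphic function \<open>G n\<close>.
\<close>

definition has_order :: "(nat \<Rightarrow> real) \<Rightarrow> real \<Rightarrow> 'n::finite tz_series \<Rightarrow> bool" where
  "has_order M s g \<longleftrightarrow>
     (\<exists>R>0. \<exists>G. (\<forall>n. multi_holomorphic_on (G n) (polydisc R) \<and> represents_on (g n) (G n) (polydisc R)) \<and>
       (\<forall>r. 0 < r \<and> r < R \<longrightarrow>
         (\<exists>A>0. \<exists>B>0. \<forall>n. \<forall>z\<in>polydisc r. cmod (G n z) \<le> A * B ^ n * M n powr s)))"


section \<open>Newton polygon\<close>

definition quadrant :: "real \<Rightarrow> real \<Rightarrow> (real \<times> real) set" where
  "quadrant a b = {(x, y). x \<le> a \<and> b \<le> y}"

definition newton_polygon ::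
  "nat \<Rightarrow> (nat \<times> ('n::finite \<Rightarrow> nat)) set \<Rightarrow> (nat \<Rightarrow> ('n \<Rightarrow> nat) \<Rightarrow> complex) \<Rightarrow>
   real \<Rightarrow> ('n \<Rightarrow> real) \<Rightarrow> (real \<times> real) set" where
  "newton_polygon K \<Lambda> a s0 s = convex hull
     (quadrant (real K * s0) (- real K) \<union>
      (\<Union>(j, \<alpha>)\<in>{(j, \<alpha>)\<in>\<Lambda>. a j \<alpha> \<noteq> 0}.
         quadrant (real j * s0 + (\<Sum>i\<in>UNIV. real (\<alpha> i) * s i)) (- real j)))"

text \<open>
  A slope is that of a non-degenerate side, cut out by a line that the polygon lies above.
  If there is no positive slope (conventionally \<open>k\<^sub>1 = \<infinity>\<close>, \<open>1/k\<^sub>1 = 0\<close>), then no real \<open>k\<close>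
  is a first positive slope.
\<close>

definition is_slope :: "(real \<times> real) set \<Rightarrow> real \<Rightarrow> bool" where
  "is_slope \<Gamma> k \<longleftrightarrow> (\<exists>c. (\<forall>(x, y)\<in>\<Gamma>. k * x + c \<le> y) \<and>
     (\<exists>p\<in>\<Gamma>. \<exists>q\<in>\<Gamma>. p \<noteq> q \<and> snd p = k * fst p + c \<and> snd q = k * fst q + c))"

definition is_first_positive_slope :: "(real \<times> real) set \<Rightarrow> real \<Rightarrow> bool" where
  "is_first_positive_slope \<Gamma> k \<longleftrightarrow>
     0 < k \<and> is_slope \<Gamma> k \<and> (\<forall>k'. 0 < k' \<and> is_slope \<Gamma> k' \<longrightarrow> k \<le> k')"

definition inverse_first_slope ::
  "nat \<Rightarrow> (nat \<times> ('n::finite \<Rightarrow> nat)) set \<Rightarrow> (nat \<Rightarrow> ('n \<Rightarrow> nat) \<Rightarrow> complex) \<Rightarrow>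
   real \<Rightarrow> ('n \<Rightarrow> real) \<Rightarrow> real" where
  "inverse_first_slope K \<Lambda> a s0 s = Max (insert 0
     ((\<lambda>(j, \<alpha>). (s0 * (real j - real K) + (\<Sum>i\<in>UNIV. s i * real (\<alpha> i))) / (real K - real j))
       ` {(j, \<alpha>)\<in>\<Lambda>. a j \<alpha> \<noteq> 0}))"

lemma is_first_positive_slope_newton_polygon_iff:
  fixes s :: "'n::finite \<Rightarrow> real"
  assumes fin: "finite \<Lambda>" and \<Lambda>: "\<And>j \<alpha>. (j, \<alpha>) \<in> \<Lambda> \<Longrightarrow> j < K"
  shows "is_first_positive_slope (newton_polygon K \<Lambda> a s0 s) k \<longleftrightarrow>
    0 < inverse_first_slope K \<Lambda> a s0 s \<and> 1 / k = inverse_first_slope K \<Lambda> a s0 s"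
proof -
  define L where "L = {(j, \<alpha>)\<in>\<Lambda>. a j \<alpha> \<noteq> 0}"
  define q where "q = (\<lambda>(j, \<alpha>). (s0 * (real j - real K) + (\<Sum>i\<in>UNIV. s i * real (\<alpha> i))) / (real K - real j))"
  define x0 where "x0 = real K * s0"
  define X where "X = (\<lambda>(j, \<alpha>). real j * s0 + (\<Sum>i\<in>UNIV. real (\<alpha> i) * s i))"
  define \<mu> where "\<mu> = inverse_first_slope K \<Lambda> a s0 s"
  define \<Gamma> where "\<Gamma> = newton_polygon K \<Lambda> a s0 s"
  define Q where "Q = quadrant x0 (- real K) \<union> (\<Union>p\<in>L. quadrant (X p) (- real (fst p)))"
  have finL: "finite L" using fin by (rule finite_subset[rotated]) (auto simp: L_def)
  have jK: "fst p < K" if "p \<in> L" for p using that \<Lambda> by (cases p) (auto simp: L_def)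
  have qX: "X p - x0 = q p * (real K - real (fst p))" if "p \<in> L" for p
    using jK[OF that] by (cases p) (simp add: X_def q_def x0_def field_simps)
  have \<mu>: "\<mu> = Max (insert 0 (q ` L))"
    by (simp add: \<mu>_def inverse_first_slope_def q_def L_def)
  have \<mu>0: "0 \<le> \<mu>" and \<mu>q: "\<And>p. p \<in> L \<Longrightarrow> q p \<le> \<mu>"
    unfolding \<mu> using finL by (auto intro: Max_ge)
  have \<mu>in: "\<mu> \<in> insert 0 (q ` L)"
    unfolding \<mu> using finL by (intro Max_in) auto
  have \<Gamma>: "\<Gamma> = convex hull Q"
    unfolding \<Gamma>_def newton_polygon_def Q_def L_def x0_def X_def
    by (rule arg_cong[where f = "\<lambda>A. convex hull A"]) (auto split: prod.splits)
  have Xle: "X p - x0 \<le> \<mu> * (real K - real (fst p))" if "p \<in> L" for p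
    unfolding qX[OF that] using \<mu>q[OF that] jK[OF that] by (intro mult_right_mono) auto
  have hull: "- real K \<le> y \<and> x - x0 \<le> \<mu> * (y + real K)" if "(x, y) \<in> \<Gamma>" for x y
  proof -
    let ?H = "{p. inner (0, - 1) p \<le> real K} \<inter> {p. inner (1, - \<mu>) p \<le> x0 + \<mu> * real K}"
    have "Q \<subseteq> ?H"
    proof
      fix w assume "w \<in> Q"
      obtain x y where w: "w = (x, y)" by (cases w)
      consider "x \<le> x0" "- real K \<le> y" | p where "p \<in> L" "x \<le> X p" "- real (fst p) \<le> y"
        using \<open>w \<in> Q\<close> by (auto simp: Q_def w quadrant_def)
      then have "- real K \<le> y \<and> x - x0 \<le> \<mu> * (y + real K)"
      proof cases
        case 1
        then have "0 \<le> \<mu> * (y + real K)" using \<mu>0 by simp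
        with 1 show ?thesis by linarith
      next
        case 2
        then have "\<mu> * (real K - real (fst p)) \<le> \<mu> * (y + real K)"
          using \<mu>0 by (intro mult_left_mono) auto
        with 2 Xle[of p] jK[of p] show ?thesis by linarith
      qed
      then show "w \<in> ?H" by (simp add: w algebra_simps)
    qed
    moreover have "convex ?H" by (intro convex_Int convex_halfspace_le)
    ultimately have "\<Gamma> \<subseteq> ?H" unfolding \<Gamma> by (rule hull_minimal)
    with that show ?thesis by (auto simp: algebra_simps)
  qed
  have corner: "(x0, - real K) \<in> \<Gamma>"
    unfolding \<Gamma> by (rule hull_inc) (simp add: Q_def quadrant_def)
  have no_slope: False if k': "0 < k'" "\<mu> * k' < 1" and "is_slope \<Gamma> k'" for k'
  proof -
    obtain c v w where c: "\<forall>(x, y)\<in>\<Gamma>. k' * x + c \<le> y" and vw: "v \<in> \<Gamma>" "w \<in> \<Gamma>" "v \<noteq> w"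
      "snd v = k' * fst v + c" "snd w = k' * fst w + c"
      using \<open>is_slope \<Gamma> k'\<close> unfolding is_slope_def by blast
    have d: "k' * x0 + c + real K \<le> 0" using c corner by fastforce
    have "fst v = x0" if "v \<in> \<Gamma>" "snd v = k' * fst v + c" for v
    proof -
      define x where "x = fst v - x0"
      define e where "e = k' * x0 + c + real K"
      have y: "snd v + real K = k' * x + e" using that by (simp add: x_def e_def algebra_simps)
      have h: "0 \<le> k' * x + e" "x \<le> \<mu> * (k' * x + e)"
        using hull[of "fst v" "snd v"] \<open>v \<in> \<Gamma>\<close> y by (auto simp: x_def)
      have e0: "e \<le> 0" using d by (simp add: e_def)
      have "0 \<le> k' * x" using h(1) e0 by linarith
      then have "0 \<le> x" using k'(1) by (simp add: zero_le_mult_iff)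
      moreover have "x \<le> \<mu> * k' * x"
        using h(2) mult_nonneg_nonpos[OF \<mu>0 e0] by (simp add: algebra_simps)
      then have "(1 - \<mu> * k') * x \<le> 0" by (simp add: algebra_simps)
      then have "x \<le> 0" using k'(2) by (simp add: mult_le_0_iff)
      ultimately show ?thesis by (simp add: x_def)
    qed
    with vw show False by (metis prod_eq_iff)
  qed
  have slope: "is_slope \<Gamma> (1 / \<mu>)" if "0 < \<mu>"
  proof -
    obtain p where p: "p \<in> L" "\<mu> = q p" using \<mu>in \<open>0 < \<mu>\<close> by blast
    have P: "(X p, - real (fst p)) \<in> \<Gamma>"
      unfolding \<Gamma> using p by (intro hull_inc) (auto simp: Q_def quadrant_def)
    have "X p - x0 = \<mu> * (real K - real (fst p))" using qX p by simp
    then have line: "- real (fst p) = 1 / \<mu> * X p + (- real K - x0 / \<mu>)"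
      using that by (simp add: field_simps)
    show ?thesis unfolding is_slope_def
    proof (intro exI[of _ "- real K - x0 / \<mu>"] conjI ballI)
      fix w assume "w \<in> \<Gamma>"
      with hull[of "fst w" "snd w"] have "fst w - x0 \<le> \<mu> * (snd w + real K)" by simp
      with that have "1 / \<mu> * fst w + (- real K - x0 / \<mu>) \<le> snd w" by (simp add: field_simps)
      then show "case w of (x, y) \<Rightarrow> 1 / \<mu> * x + (- real K - x0 / \<mu>) \<le> y"
        by (simp add: case_prod_beta)
    next
      have "(X p, - real (fst p)) \<noteq> (x0, - real K)" using jK[OF p(1)] by simp
      moreover have "snd (x0, - real K) = 1 / \<mu> * fst (x0, - real K) + (- real K - x0 / \<mu>)" by simp
      moreover have "snd (X p, - real (fst p)) = 1 / \<mu> * fst (X p, - real (fst p)) + (- real K - x0 / \<mu>)"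
        using line by simp
      ultimately show "\<exists>v\<in>\<Gamma>. \<exists>w\<in>\<Gamma>. v \<noteq> w \<and> snd v = 1 / \<mu> * fst v + (- real K - x0 / \<mu>) \<and>
        snd w = 1 / \<mu> * fst w + (- real K - x0 / \<mu>)"
        using P corner by blast
    qed
  qed
  have least: "1 / \<mu> \<le> k'" if "0 < \<mu>" "0 < k'" "is_slope \<Gamma> k'" for k'
    using no_slope[of k'] that by (force simp: field_simps)
  show ?thesis
    unfolding \<Gamma>_def[symmetric] \<mu>_def[symmetric]
  proof
    assume k: "is_first_positive_slope \<Gamma> k"
    then have "0 < \<mu>" using no_slope[of k] \<mu>0 by (cases "\<mu> = 0") (auto simp: is_first_positive_slope_def)
    moreover from this have "k = 1 / \<mu>"
      using k slope least by (auto simp: is_first_positive_slope_def intro!: antisym)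
    ultimately show "0 < \<mu> \<and> 1 / k = \<mu>" by simp
  next
    assume k: "0 < \<mu> \<and> 1 / k = \<mu>"
    then have "k = 1 / \<mu>" by auto
    with k show "is_first_positive_slope \<Gamma> k"
      using slope least by (auto simp: is_first_positive_slope_def)
  qed
qed

end

theory Submission
  imports Defs
begin

text \<open>
  Being of order \<open>\<sigma> = 1 / k\<^sub>1\<close> is equivalent to a bound
  \<open>\<bar>g n \<beta>\<bar> \<le> A B\<^sup>n C ^ \<bar>\<beta>\<bar> M\<^sub>n ^ \<sigma>\<close> on the coefficients, so no function theory is needed beyond Cauchy's
  estimate. Multiplying the coefficients by \<open>m\<^sub>0(n) \<Prod> m\<^sub>i(\<beta>\<^sub>i)\<close> turns the equation into the
  recurrence \<open>v (n + K) \<beta> = g n \<beta> + \<Sum> a\<^sub>j\<^sub>\<alpha> v (n + j) (\<beta> + \<alpha>)\<close>. Hence \<open>v n \<beta>\<close> is a sum of at most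
  exponentially many terms \<open>g n' (\<beta> + \<gamma>)\<close>, and by the definition of \<open>k\<^sub>1\<close> these satisfy
  \<open>s \<cdot> \<gamma> \<le> S (n - n')\<close> with \<open>S = \<sigma> + s\<^sub>0\<close>. Since \<open>\<sigma> > 0\<close>, the maximum defining it is attained, so
  \<open>S = s \<cdot> \<alpha> / (K - j)\<close> for some \<open>(j, \<alpha>) \<in> \<Lambda>\<close>, and \<open>S\<close> is rational even though \<open>s\<^sub>0\<close> need not be.
  Rationality of \<open>S\<close> and \<open>s\<close> gives \<open>\<Prod> M(\<gamma>\<^sub>i) ^ s\<^sub>i \<le> E\<^sup>k M\<^sub>k ^ S\<close> for \<open>k = n - n'\<close>, which
  absorbs the shift \<open>\<gamma>\<close>.
\<close>

section \<open>Products of powers of the sequence\<close>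

lemma finite_Rats_common_denominator:
  assumes "finite A" "A \<subseteq> \<rat>" "\<And>x. x \<in> A \<Longrightarrow> 0 \<le> x"
  shows "\<exists>q>0. \<forall>x\<in>A. \<exists>p. x = real p / real q"
  using assms
proof (induction A)
  case (insert x A)
  then obtain q where q: "q > 0" "\<forall>x\<in>A. \<exists>p. x = real p / real q" by auto
  have "x \<in> \<rat>" "0 \<le> x" using insert.prems by auto
  then obtain p' q' :: nat where x: "q' \<noteq> 0" "x = real p' / real q'"
    by (metis Rats_abs_nat_div_natE abs_of_nonneg)
  show ?case
  proof (rule exI[of _ "q * q'"], intro conjI ballI)
    show "0 < q * q'" using q x by simp
    fix y assume "y \<in> insert x A"
    then consider "y = x" | "y \<in> A" by blast
    then show "\<exists>p. y = real p / real (q * q')"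
    proof cases
      case 1
      then have "y = real (q * p') / real (q * q')" using q x by (simp add: field_simps)
      then show ?thesis by blast
    next
      case 2
      then obtain p where "y = real p / real q" using q by blast
      then have "y = real (p * q') / real (q * q')" using q x by (simp add: field_simps)
      then show ?thesis by blast
    qed
  qed
next
  case empty
  show ?case by (rule exI[of _ 1]) simp
qed

text \<open>Enlarging the constant to at least 1 makes its powers monotone in the exponent, so that
  exponents can be rounded up freely in later estimates.\<close>

lemma moderate_growthE:
  assumes "moderate_growth M" "\<And>n. 0 < M n"
  obtains H where "1 \<le> H" "\<And>n k. M (n + k) \<le> H ^ (n + k) * M n * M k"
proof -
  obtain B where B: "\<And>n k. M (n + k) \<le> B ^ (n + k) * M n * M k" "B > 0"
    using assms(1) unfolding moderate_growth_def by blast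
  have "M (n + k) \<le> (max 1 B) ^ (n + k) * M n * M k" for n k
    using B(1)[of n k] by (rule order_trans) (use B(2) assms(2) in \<open>auto intro!: mult_right_mono power_mono simp: less_imp_le\<close>)
  then show ?thesis using that[of "max 1 B"] by simp
qed

text \<open>Dividing by \<open>b ^ (n + k)\<close> turns (star) into an upper bound for products;
  the constant \<open>1 / b\<close> is again enlarged to at least 1.\<close>

lemma star_conditionE:
  assumes "star_condition M" "\<And>n. 0 < M n"
  obtains h where "1 \<le> h" "\<And>n k. M n * M k \<le> h ^ (n + k) * M (n + k)"
proof -
  obtain b where b: "\<And>n k. b ^ (n + k) * M n * M k \<le> M (n + k)" "b > 0"
    using assms(1) unfolding star_condition_def by blast
  have "M n * M k \<le> (max 1 (1 / b)) ^ (n + k) * M (n + k)" for n k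
  proof -
    have "M n * M k \<le> (1 / b) ^ (n + k) * M (n + k)"
      using b(1)[of n k] b(2) by (simp add: field_simps power_one_over)
    also have "\<dots> \<le> (max 1 (1 / b)) ^ (n + k) * M (n + k)"
      using b(2) assms(2) by (auto intro!: mult_right_mono power_mono simp: less_imp_le)
    finally show ?thesis .
  qed
  then show ?thesis using that[of "max 1 (1 / b)"] by simp
qed

text \<open>One factor \<open>M k\<close> is split off per induction step. The exponent of
  \<open>H\<close> is generous in \<open>p\<close> but linear in \<open>k\<close>, so for fixed
  \<open>p\<close> the loss is only geometric in \<open>k\<close>.\<close>

lemma moderate_growth_power:
  assumes H: "1 \<le> H" "\<And>n k. M (n + k) \<le> H ^ (n + k) * M n * M k"
    and M: "\<And>n. 0 < M n" "M 0 = (1 :: real)"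
  shows "M (p * k) \<le> H ^ (p * (p * k)) * M k ^ p"
proof (induction p)
  case (Suc p)
  have "M (Suc p * k) \<le> H ^ (Suc p * k) * M k * M (p * k)"
    using H(2)[of k "p * k"] by simp
  also have "\<dots> \<le> H ^ (Suc p * k) * M k * (H ^ (p * (p * k)) * M k ^ p)"
    using Suc H(1) M(1)[of k] by (intro mult_left_mono) auto
  also have "\<dots> = H ^ (Suc p * k + p * (p * k)) * M k ^ Suc p"
    by (simp add: power_add mult_ac)
  also have "\<dots> \<le> H ^ (Suc p * (Suc p * k)) * M k ^ Suc p"
    using H(1) M(1)[of k] by (intro mult_right_mono power_increasing) (auto simp: algebra_simps)
  finally show ?case .
qed (use M in simp)

text \<open>The reverse comparison: one factor \<open>M k\<close> is merged per induction step,
  again with a loss that is geometric in \<open>k\<close> for fixed \<open>p\<close>.\<close>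

lemma star_condition_power:
  assumes h: "1 \<le> h" "\<And>n k. M n * M k \<le> h ^ (n + k) * M (n + k)"
    and M: "\<And>n. 0 < M n" "M 0 = (1 :: real)"
  shows "M k ^ p \<le> h ^ (p * (p * k)) * M (p * k)"
proof (induction p)
  case (Suc p)
  have "M k ^ Suc p \<le> M k * (h ^ (p * (p * k)) * M (p * k))"
    using Suc M(1)[of k] by (auto intro!: mult_left_mono)
  also have "\<dots> = h ^ (p * (p * k)) * (M k * M (p * k))" by simp
  also have "\<dots> \<le> h ^ (p * (p * k)) * (h ^ (Suc p * k) * M (Suc p * k))"
    using h(1) h(2)[of k "p * k"] by (intro mult_left_mono) auto
  also have "\<dots> = h ^ (p * (p * k) + Suc p * k) * M (Suc p * k)"
    by (simp add: power_add mult_ac)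
  also have "\<dots> \<le> h ^ (Suc p * (Suc p * k)) * M (Suc p * k)"
    using h(1) M(1) by (intro mult_right_mono power_increasing) (auto simp: algebra_simps less_imp_le)
  finally show ?case .
qed (use M in simp)

lemma star_condition_prod:
  assumes h: "1 \<le> h" "\<And>n k. M n * M k \<le> h ^ (n + k) * M (n + k)"
    and M: "\<And>n. 0 < M n" "M 0 = (1 :: real)" and "finite I"
  shows "(\<Prod>i\<in>I. M (x i)) \<le> h ^ (card I * sum x I) * M (sum x I)"
  using \<open>finite I\<close>
proof (induction I)
  case (insert j I)
  have "(\<Prod>i\<in>insert j I. M (x i)) \<le> M (x j) * (h ^ (card I * sum x I) * M (sum x I))"
    using insert M(1)[of "x j"] by (auto intro!: mult_left_mono)
  also have "\<dots> = h ^ (card I * sum x I) * (M (x j) * M (sum x I))" by simp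
  also have "\<dots> \<le> h ^ (card I * sum x I) * (h ^ (x j + sum x I) * M (x j + sum x I))"
    using h(1) h(2)[of "x j" "sum x I"] by (intro mult_left_mono) auto
  also have "\<dots> = h ^ (card I * sum x I + (x j + sum x I)) * M (x j + sum x I)"
    by (simp add: power_add mult_ac)
  also have "\<dots> \<le> h ^ (card (insert j I) * sum x (insert j I)) * M (sum x (insert j I))"
    using h(1) M(1) insert
    by (auto intro!: mult_right_mono power_increasing simp: algebra_simps less_imp_le)
  finally show ?case .
qed (use M in simp)

text \<open>
  Rationality of the exponents enters here: over a common denominator the product of powers
  becomes a product of integer powers, which \<open>(\<star>)\<close>, monotonicity and (mg) compare with a power
  of a single term.
\<close>
lemma prod_powr_le_powr:
  fixes M :: "nat \<Rightarrow> real" and s :: "'n::finite \<Rightarrow> real"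
  assumes M: "incseq M" "\<And>n. 0 < M n" "M 0 = 1" "moderate_growth M" "star_condition M"
    and s: "\<And>i. 0 \<le> s i" "\<And>i. s i \<in> \<rat>" and S: "0 \<le> S" "S \<in> \<rat>"
  shows "\<exists>E\<ge>1. \<forall>k \<gamma>. (\<Sum>i\<in>UNIV. s i * real (\<gamma> i)) \<le> S * real k \<longrightarrow>
    (\<Prod>i\<in>UNIV. M (\<gamma> i) powr s i) \<le> E ^ k * M k powr S"
proof -
  obtain H where H: "1 \<le> H" "\<And>n k. M (n + k) \<le> H ^ (n + k) * M n * M k"
    using moderate_growthE[OF M(4,2)] by blast
  obtain h where h: "1 \<le> h" "\<And>n k. M n * M k \<le> h ^ (n + k) * M (n + k)"
    using star_conditionE[OF M(5,2)] by blast
  have "\<exists>q>0. \<forall>x\<in>insert S (range s). \<exists>p. x = real p / real q"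
    using s S by (intro finite_Rats_common_denominator) auto
  then obtain q where q: "q > 0" "\<And>x. x \<in> insert S (range s) \<Longrightarrow> \<exists>p. x = real p / real q"
    by blast
  obtain P where P: "S = real P / real q" using q(2) by blast
  obtain p where p: "\<And>i. s i = real (p i) / real q" 
    using q(2)[OF insertI2[OF rangeI]] by metis
  \<comment> \<open>\<open>c\<close> collects the powers of \<open>h\<close>:
    \<open>P * sum p UNIV\<close> from moving the exponents \<open>p i\<close> into the index,
    \<open>P * CARD('n)\<close> from merging the product into one term. \<open>H ^ (P * P)\<close>
    pays for moving \<open>P\<close> out of the index again.\<close>
  define c where "c = P * (CARD('n) + sum p UNIV)"
  define E where "E = h ^ c * H ^ (P * P)"
  have E1: "1 \<le> E" unfolding E_def using h(1) H(1)
    by (metis mult_mono' one_le_power mult_1 zero_le_one)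
  have "(\<Prod>i\<in>UNIV. M (\<gamma> i) powr s i) \<le> (E powr (1 / q)) ^ k * M k powr S"
    if \<gamma>: "(\<Sum>i\<in>UNIV. s i * real (\<gamma> i)) \<le> S * real k" for k \<gamma>
  proof -
    \<comment> \<open>Multiplied by the common denominator, the hypothesis compares natural numbers,
      which can serve as indices of \<open>M\<close>.\<close>
    have "real (\<Sum>i\<in>UNIV. p i * \<gamma> i) = real q * (\<Sum>i\<in>UNIV. s i * real (\<gamma> i))"
      using q(1) by (simp add: p sum_distrib_left)
    also have "\<dots> \<le> real q * (S * real k)" using \<gamma> by (intro mult_left_mono) auto
    also have "\<dots> = real (P * k)" using q(1) P by simp
    finally have le: "(\<Sum>i\<in>UNIV. p i * \<gamma> i) \<le> P * k" by linarith
    have lei: "p i * \<gamma> i \<le> P * k" for i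
      using member_le_sum[of i UNIV "\<lambda>i. p i * \<gamma> i"] le by simp
    have "(\<Prod>i\<in>UNIV. M (\<gamma> i) ^ p i) \<le> (\<Prod>i\<in>UNIV. h ^ (p i * (p i * \<gamma> i)) * M (p i * \<gamma> i))"
      by (intro prod_mono) (auto intro!: star_condition_power[OF h M(2,3)] simp: M(2) less_imp_le)
    also have "\<dots> \<le> (\<Prod>i\<in>UNIV. h ^ (p i * (P * k)) * M (p i * \<gamma> i))"
      using h(1) lei M(2)
      by (intro prod_mono conjI mult_right_mono power_increasing mult_left_mono) (auto simp: less_imp_le)
    also have "\<dots> = h ^ (sum p UNIV * (P * k)) * (\<Prod>i\<in>UNIV. M (p i * \<gamma> i))"
      by (simp add: prod.distrib power_sum sum_distrib_right)
    also have "\<dots> \<le> h ^ (sum p UNIV * (P * k)) * (h ^ (CARD('n) * (P * k)) * M (P * k))"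
    proof (intro mult_left_mono)
      have "(\<Prod>i\<in>UNIV. M (p i * \<gamma> i)) \<le> h ^ (CARD('n) * (\<Sum>i\<in>UNIV. p i * \<gamma> i)) * M (\<Sum>i\<in>UNIV. p i * \<gamma> i)"
        by (rule star_condition_prod[OF h M(2,3)]) auto
      also have "\<dots> \<le> h ^ (CARD('n) * (P * k)) * M (P * k)"
        using h(1) le incseqD[OF M(1) le] M(2)
        by (intro mult_mono power_increasing) (auto simp: less_imp_le)
      finally show "(\<Prod>i\<in>UNIV. M (p i * \<gamma> i)) \<le> h ^ (CARD('n) * (P * k)) * M (P * k)" .
    qed (use h(1) in simp)
    also have "\<dots> = h ^ (c * k) * M (P * k)"
      by (simp add: c_def power_add[symmetric] algebra_simps)
    also have "\<dots> \<le> h ^ (c * k) * (H ^ (P * (P * k)) * M k ^ P)"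
      using h(1) by (intro mult_left_mono moderate_growth_power[OF H M(2,3)]) auto
    also have "\<dots> = E ^ k * M k ^ P"
      by (simp add: E_def power_mult power_mult_distrib mult_ac)
    \<comment> \<open>Taking \<open>q\<close>-th roots restores the rational exponents.\<close>
    finally have "(\<Prod>i\<in>UNIV. M (\<gamma> i) ^ p i) powr (1 / q) \<le> (E ^ k * M k ^ P) powr (1 / q)"
      by (intro powr_mono2) (auto simp: M(2) less_imp_le intro!: prod_nonneg)
    moreover have "(\<Prod>i\<in>UNIV. M (\<gamma> i) ^ p i) powr (1 / q) = (\<Prod>i\<in>UNIV. M (\<gamma> i) powr s i)"
      using M(2) by (simp add: prod_powr_distrib less_imp_le powr_realpow[symmetric] powr_powr p)
    moreover have "(E ^ k * M k ^ P) powr (1 / q) = (E powr (1 / q)) ^ k * M k powr S"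
      using M(2) E1 by (simp add: powr_mult powr_realpow[symmetric] powr_powr P powr_power mult_ac)
    ultimately show ?thesis by simp
  qed
  moreover have "1 \<le> E powr (1 / q)" using E1 by (intro ge_one_powr_ge_zero) auto
  ultimately show ?thesis by blast
qed

section \<open>Coefficient bounds for the formal solution\<close>

text \<open>
  Unrolling the recurrence expresses \<open>v n \<beta>\<close> through values of \<open>g\<close>; carrying one bound \<open>X\<close> for all
  of those that are reachable avoids losing a factor \<open>C ^ \<bar>\<beta>\<bar>\<close> in each step.
\<close>
lemma recurrence_bound:
  fixes v g :: "nat \<Rightarrow> ('n::finite \<Rightarrow> nat) \<Rightarrow> complex" and w :: "('n \<Rightarrow> nat) \<Rightarrow> real"
  assumes zero: "\<And>n \<beta>. n < K \<Longrightarrow> v n \<beta> = 0"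
    and rec: "\<And>n \<beta>. v (n + K) \<beta> = g n \<beta> + (\<Sum>(j, \<alpha>)\<in>\<Lambda>. a j \<alpha> * v (n + j) (\<lambda>i. \<beta> i + \<alpha> i))"
    and \<Lambda>: "\<And>j \<alpha>. (j, \<alpha>) \<in> \<Lambda> \<Longrightarrow> j < K"
    and w: "\<And>j \<alpha>. (j, \<alpha>) \<in> \<Lambda> \<Longrightarrow> a j \<alpha> \<noteq> 0 \<Longrightarrow> w \<alpha> \<le> S * (real K - real j)"
    and w_add: "\<And>\<alpha> \<beta>. w (\<lambda>i. \<alpha> i + \<beta> i) = w \<alpha> + w \<beta>" and "0 \<le> S"
    and c: "\<And>j \<alpha>. (j, \<alpha>) \<in> \<Lambda> \<Longrightarrow> sum \<alpha> UNIV \<le> c"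
    and X: "0 \<le> X" "\<And>n' \<gamma>. n' \<le> n \<Longrightarrow> w \<gamma> \<le> S * real (n - n') \<Longrightarrow> sum \<gamma> UNIV \<le> c * (n - n') \<Longrightarrow>
      cmod (g n' (\<lambda>i. \<beta> i + \<gamma> i)) \<le> X"
  shows "cmod (v n \<beta>) \<le> (1 + (\<Sum>(j, \<alpha>)\<in>\<Lambda>. cmod (a j \<alpha>))) ^ n * X"
  using X(2)
proof (induction n arbitrary: \<beta> rule: less_induct)
  case (less n)
  define L where "L = (\<Sum>(j, \<alpha>)\<in>\<Lambda>. cmod (a j \<alpha>))"
  have L: "0 \<le> L" unfolding L_def by (auto intro!: sum_nonneg)
  show ?case
  proof (cases "n < K")
    case True
    with zero L X(1) show ?thesis unfolding L_def[symmetric] by simp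
  next
    case nK: False
    define n0 where "n0 = n - K"
    have n0: "n = n0 + K" using nK by (simp add: n0_def)
    have w0: "w (\<lambda>i. 0) = 0" using w_add[of "\<lambda>i. 0" "\<lambda>i. 0"] by simp
    have g: "cmod (g n0 \<beta>) \<le> X"
      using less.prems[of n0 "\<lambda>i. 0"] \<open>0 \<le> S\<close> by (simp add: w0 n0)
    have K0: "n > 0" if "(j, \<alpha>) \<in> \<Lambda>" for j \<alpha> using \<Lambda>[OF that] n0 by simp
    \<comment> \<open>The exponent \<open>n - 1\<close> is uniform in \<open>j\<close>, because j <
      K gives n0 + j \<le> n - 1.\<close>
    have step: "cmod (a j \<alpha> * v (n0 + j) (\<lambda>i. \<beta> i + \<alpha> i)) \<le> cmod (a j \<alpha>) * ((1 + L) ^ (n - 1) * X)"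
      if jl: "(j, \<alpha>) \<in> \<Lambda>" for j \<alpha>
    proof (cases "a j \<alpha> = 0")
      case False
      have jK: "j < K" using \<Lambda> jl by blast
      have "cmod (v (n0 + j) (\<lambda>i. \<beta> i + \<alpha> i)) \<le> (1 + L) ^ (n0 + j) * X"
        unfolding L_def
      proof (rule less.IH)
        fix n' \<gamma>
        assume *: "n' \<le> n0 + j" "w \<gamma> \<le> S * real (n0 + j - n')" "sum \<gamma> UNIV \<le> c * (n0 + j - n')"
        \<comment> \<open>A shift reachable from \<beta> + \<alpha> is prolonged by \<alpha>. The
          cost of \<alpha> is covered by the K - j levels descended, so the combined shift stays
          admissible for \<open>n\<close>.\<close>
        have "w (\<lambda>i. \<alpha> i + \<gamma> i) \<le> S * (real K - real j) + S * real (n0 + j - n')"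
          using w[OF jl False] * by (simp add: w_add)
        also have "\<dots> = S * real (n - n')"
          using * jK by (simp add: n0 of_nat_diff algebra_simps)
        finally have 1: "w (\<lambda>i. \<alpha> i + \<gamma> i) \<le> S * real (n - n')" .
        have "sum (\<lambda>i. \<alpha> i + \<gamma> i) UNIV \<le> c + c * (n0 + j - n')"
          using c[OF jl] * by (simp add: sum.distrib add_mono)
        \<comment> \<open>At least one level is descended, which pays for the \<open>c\<close> that
          \<alpha> may add to the length of the shift.\<close>
        also have "\<dots> = c * Suc (n0 + j - n')" by simp
        also have "\<dots> \<le> c * (n - n')"
          using * jK by (intro mult_le_mono) (auto simp: n0)
        finally have 2: "sum (\<lambda>i. \<alpha> i + \<gamma> i) UNIV \<le> c * (n - n')" .
        show "cmod (g n' (\<lambda>i. \<beta> i + \<alpha> i + \<gamma> i)) \<le> X"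
          using less.prems[OF _ 1 2] * jK by (simp add: n0 add.assoc)
      qed (use jK n0 in simp)
      also have "\<dots> \<le> (1 + L) ^ (n - 1) * X"
        using L X(1) jK by (intro mult_right_mono power_increasing) (auto simp: n0)
      finally show ?thesis by (simp add: norm_mult mult_left_mono)
    qed simp
    have "cmod (v n \<beta>) \<le> cmod (g n0 \<beta>) + cmod (\<Sum>(j, \<alpha>)\<in>\<Lambda>. a j \<alpha> * v (n0 + j) (\<lambda>i. \<beta> i + \<alpha> i))"
      unfolding n0 rec by (rule norm_triangle_ineq)
    also have "\<dots> \<le> X + (\<Sum>(j, \<alpha>)\<in>\<Lambda>. cmod (a j \<alpha>) * ((1 + L) ^ (n - 1) * X))"
      using g step by (intro add_mono sum_norm_le) auto
    also have "\<dots> = X + L * ((1 + L) ^ (n - 1) * X)"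
      by (simp add: L_def sum_distrib_right case_prod_beta)
    also have "\<dots> \<le> (1 + L) ^ n * X"
    \<comment> \<open>At n = 0 the subtraction in \<open>n - 1\<close> truncates; then K = 0, and
      \<Lambda> is empty since its elements satisfy j < K.\<close>
    proof (cases n)
      case 0
      with K0 have "\<Lambda> = {}" by fast
      then show ?thesis using 0 by (simp add: L_def)
    next
      case (Suc k)
      have "X \<le> (1 + L) ^ k * X" using L X(1) mult_right_mono[of 1 "(1 + L) ^ k" X] by simp
      then show ?thesis by (simp add: Suc algebra_simps)
    qed
    finally show ?thesis unfolding L_def .
  qed
qed

section \<open>Moment sequences as weights on the coefficients\<close>

lemma is_seq_of_orderE:
  assumes "is_seq_of_order M s m"
  obtains a A where "0 < a" "1 \<le> A" "\<And>n. 0 < m n" "\<And>n. a ^ n * M n powr s \<le> m n"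
    "\<And>n. m n \<le> A ^ n * M n powr s"
proof -
  obtain a A where aA: "0 < a" "0 < A" "\<And>n. 0 < m n" "\<And>n. a ^ n * M n powr s \<le> m n"
    "\<And>n. m n \<le> A ^ n * M n powr s"
    using assms unfolding is_seq_of_order_def by blast
  have "m n \<le> max 1 A ^ n * M n powr s" for n
    using aA(5)[of n] by (rule order_trans) (use aA(2) in \<open>auto intro!: mult_right_mono power_mono\<close>)
  then show ?thesis using that[of a "max 1 A"] aA by simp
qed

text \<open>The quotients of moments produced by the operators telescope against the weight, so each
  m-derivative becomes a plain index shift and the recurrence has the constant coefficients
  \<open>a j \<alpha>\<close>.\<close>

lemma formal_solution_recurrence:
  fixes m :: "'n::finite \<Rightarrow> nat \<Rightarrow> real"
  assumes m0: "\<And>n. m0 n \<noteq> 0" and m: "\<And>i n. m i n \<noteq> 0"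
    and sol: "formal_solution K \<Lambda> a m0 m f u"
  defines "W \<equiv> \<lambda>x n \<beta>. of_real (m0 n * (\<Prod>i\<in>UNIV. m i (\<beta> i))) * (x n \<beta> :: complex)"
  shows "n < K \<Longrightarrow> W u n \<beta> = 0"
    and "W u (n + K) \<beta> = W f n \<beta> + (\<Sum>(j, \<alpha>)\<in>\<Lambda>. a j \<alpha> * W u (n + j) (\<lambda>i. \<beta> i + \<alpha> i))"
proof -
  note * = formal_solution_iff[of m0, OF m0, THEN iffD1, OF sol, rule_format]
  show "n < K \<Longrightarrow> W u n \<beta> = 0" using *[of n] by (simp add: W_def)
  let ?m = "\<lambda>\<beta>. \<Prod>i\<in>UNIV. m i (\<beta> i)"
  have "?m \<beta> \<noteq> 0" using m by simp
  have "u (n + K) \<beta> = of_real (m0 n) / of_real (m0 (n + K)) *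
      (f n \<beta> + (\<Sum>(j, \<alpha>)\<in>\<Lambda>. a j \<alpha> * (of_real (m0 (n + j)) *
        (of_real (\<Prod>i\<in>UNIV. m i (\<beta> i + \<alpha> i) / m i (\<beta> i)) * u (n + j) (\<lambda>i. \<beta> i + \<alpha> i)) / of_real (m0 n))))"
    using *[of "n + K"] by (simp add: mdiff_z_multi_eq[of m, OF m])
  then have "W u (n + K) \<beta> = of_real (m0 n * ?m \<beta>) *
      (f n \<beta> + (\<Sum>(j, \<alpha>)\<in>\<Lambda>. a j \<alpha> * (of_real (m0 (n + j)) *
        (of_real (\<Prod>i\<in>UNIV. m i (\<beta> i + \<alpha> i) / m i (\<beta> i)) * u (n + j) (\<lambda>i. \<beta> i + \<alpha> i)) / of_real (m0 n))))"
    using m0 by (simp add: W_def)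
  also have "\<dots> = W f n \<beta> + (\<Sum>(j, \<alpha>)\<in>\<Lambda>. of_real (m0 n * ?m \<beta>) * (a j \<alpha> * (of_real (m0 (n + j)) *
        (of_real (\<Prod>i\<in>UNIV. m i (\<beta> i + \<alpha> i) / m i (\<beta> i)) * u (n + j) (\<lambda>i. \<beta> i + \<alpha> i)) / of_real (m0 n))))"
    by (simp add: W_def distrib_left sum_distrib_left case_prod_beta)
  also have "(\<Sum>(j, \<alpha>)\<in>\<Lambda>. of_real (m0 n * ?m \<beta>) * (a j \<alpha> * (of_real (m0 (n + j)) *
        (of_real (\<Prod>i\<in>UNIV. m i (\<beta> i + \<alpha> i) / m i (\<beta> i)) * u (n + j) (\<lambda>i. \<beta> i + \<alpha> i)) / of_real (m0 n))))
      = (\<Sum>(j, \<alpha>)\<in>\<Lambda>. a j \<alpha> * W u (n + j) (\<lambda>i. \<beta> i + \<alpha> i))"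
    using m0 m by (intro sum.cong) (auto simp: W_def prod_dividef)
  finally show "W u (n + K) \<beta> = W f n \<beta> + (\<Sum>(j, \<alpha>)\<in>\<Lambda>. a j \<alpha> * W u (n + j) (\<lambda>i. \<beta> i + \<alpha> i))" .
qed

text \<open>A form of \<open>has_order\<close> suited to recurrences: the constant \<open>C\<close>,
  independent of \<open>n\<close>, plays the role of an inverse radius. The equivalence is
  \<open>coeff_order_imp_has_order\<close> together with
  \<open>has_order_imp_coeff_order\<close>.\<close>

definition coeff_order :: "(nat \<Rightarrow> real) \<Rightarrow> real \<Rightarrow> 'n::finite tz_series \<Rightarrow> bool" where
  "coeff_order M s g \<longleftrightarrow> (\<exists>A>0. \<exists>B>0. \<exists>C>0. \<forall>n \<beta>.
     cmod (g n \<beta>) \<le> A * B ^ n * C ^ (sum \<beta> UNIV) * M n powr s)"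

lemma coeff_orderE:
  assumes "coeff_order M s g"
  obtains A B C where "0 < A" "1 \<le> B" "1 \<le> C"
    "\<And>n \<beta>. cmod (g n \<beta>) \<le> A * B ^ n * C ^ (sum \<beta> UNIV) * M n powr s"
proof -
  obtain A B C where ABC: "0 < A" "0 < B" "0 < C"
    "\<And>n \<beta>. cmod (g n \<beta>) \<le> A * B ^ n * C ^ (sum \<beta> UNIV) * M n powr s"
    using assms unfolding coeff_order_def by blast
  have "cmod (g n \<beta>) \<le> A * max 1 B ^ n * max 1 C ^ (sum \<beta> UNIV) * M n powr s" for n \<beta>
    using ABC(4)[of n \<beta>] by (rule order_trans)
      (use ABC in \<open>auto intro!: mult_right_mono mult_mono power_mono\<close>)
  then show ?thesis using that[of A "max 1 B" "max 1 C"] ABC by simp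
qed

text \<open>Separates a shift \<gamma> from the index \<beta> by (mg) in each variable. Since H
  \<ge> 1, the single base \<open>H powr sum s UNIV\<close> dominates every
  \<open>H powr s i\<close>.\<close>

lemma prod_moderate_growth:
  fixes s :: "'n::finite \<Rightarrow> real"
  assumes H: "1 \<le> H" "\<And>n k. M (n + k) \<le> H ^ (n + k) * M n * M k"
    and M: "\<And>n. (0 :: real) < M n" and s: "\<And>i. 0 \<le> s i"
  shows "(\<Prod>i\<in>UNIV. M (\<beta> i + \<gamma> i) powr s i) \<le> (H powr sum s UNIV) ^ (sum \<beta> UNIV + sum \<gamma> UNIV) *
    ((\<Prod>i\<in>UNIV. M (\<beta> i) powr s i) * (\<Prod>i\<in>UNIV. M (\<gamma> i) powr s i))"
proof -
  have "(\<Prod>i\<in>UNIV. M (\<beta> i + \<gamma> i) powr s i) \<le>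
      (\<Prod>i\<in>UNIV. (H powr sum s UNIV) ^ (\<beta> i + \<gamma> i) * (M (\<beta> i) powr s i * M (\<gamma> i) powr s i))"
  proof (intro prod_mono conjI)
    fix i
    have "M (\<beta> i + \<gamma> i) powr s i \<le> (H ^ (\<beta> i + \<gamma> i) * M (\<beta> i) * M (\<gamma> i)) powr s i"
      using M s H by (intro powr_mono2) (auto simp: less_imp_le)
    also have "\<dots> = (H ^ (\<beta> i + \<gamma> i)) powr s i * (M (\<beta> i) powr s i * M (\<gamma> i) powr s i)"
      using M H(1) by (simp add: powr_mult less_imp_le)
    also have "(H ^ (\<beta> i + \<gamma> i)) powr s i = (H powr s i) ^ (\<beta> i + \<gamma> i)"
      using H(1) by (simp add: powr_realpow[symmetric] powr_powr mult.commute)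
    also have "\<dots> * (M (\<beta> i) powr s i * M (\<gamma> i) powr s i) \<le>
        (H powr sum s UNIV) ^ (\<beta> i + \<gamma> i) * (M (\<beta> i) powr s i * M (\<gamma> i) powr s i)"
      using H(1) s by (intro mult_right_mono power_mono powr_mono member_le_sum) auto
    finally show "M (\<beta> i + \<gamma> i) powr s i \<le>
      (H powr sum s UNIV) ^ (\<beta> i + \<gamma> i) * (M (\<beta> i) powr s i * M (\<gamma> i) powr s i)" .
  qed auto
  also have "\<dots> = (H powr sum s UNIV) ^ (sum \<beta> UNIV + sum \<gamma> UNIV) *
    ((\<Prod>i\<in>UNIV. M (\<beta> i) powr s i) * (\<Prod>i\<in>UNIV. M (\<gamma> i) powr s i))"
    by (simp add: prod.distrib power_sum[symmetric] sum.distrib)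
  finally show ?thesis .
qed

text \<open>There are finitely many variables, so the least lower constant and the greatest upper
  constant serve all of them.\<close>

lemma is_seq_of_order_familyE:
  fixes m :: "'n::finite \<Rightarrow> nat \<Rightarrow> real"
  assumes "\<And>i. is_seq_of_order M (s i) (m i)"
  obtains a A where "0 < a" "1 \<le> A" "\<And>i n. 0 < m i n"
    "\<And>\<beta>. a ^ (sum \<beta> UNIV) * (\<Prod>i\<in>UNIV. M (\<beta> i) powr s i) \<le> (\<Prod>i\<in>UNIV. m i (\<beta> i))"
    "\<And>\<beta>. (\<Prod>i\<in>UNIV. m i (\<beta> i)) \<le> A ^ (sum \<beta> UNIV) * (\<Prod>i\<in>UNIV. M (\<beta> i) powr s i)"
proof -
  have "\<exists>a A. 0 < a \<and> 1 \<le> A \<and> (\<forall>n. 0 < m i n \<and> a ^ n * M n powr s i \<le> m i n \<and> m i n \<le> A ^ n * M n powr s i)" for i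
    using is_seq_of_orderE[OF assms[of i]] by metis
  then obtain a A where aA: "\<And>i. 0 < a i" "\<And>i. 1 \<le> A i" "\<And>i n. 0 < m i n"
    "\<And>i n. a i ^ n * M n powr s i \<le> m i n" "\<And>i n. m i n \<le> A i ^ n * M n powr s i"
    by metis
  define a' where "a' = Min (range a)"
  define A' where "A' = Max (range A)"
  have a': "0 < a'" "\<And>i. a' \<le> a i" using aA(1) by (auto simp: a'_def)
  have A': "\<And>i. A i \<le> A'" by (auto simp: A'_def)
  then have "1 \<le> A'" using aA(2) order_trans by blast
  moreover have "a' ^ (sum \<beta> UNIV) * (\<Prod>i\<in>UNIV. M (\<beta> i) powr s i) \<le> (\<Prod>i\<in>UNIV. m i (\<beta> i))" for \<beta>
  proof -
    have "(\<Prod>i\<in>UNIV. a' ^ \<beta> i * M (\<beta> i) powr s i) \<le> (\<Prod>i\<in>UNIV. m i (\<beta> i))"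
    proof (intro prod_mono conjI)
      fix i
      have "a' ^ \<beta> i * M (\<beta> i) powr s i \<le> a i ^ \<beta> i * M (\<beta> i) powr s i"
        using a' by (intro mult_right_mono power_mono) (auto simp: less_imp_le)
      also have "\<dots> \<le> m i (\<beta> i)" by (rule aA)
      finally show "a' ^ \<beta> i * M (\<beta> i) powr s i \<le> m i (\<beta> i)" .
    qed (use a' in auto)
    then show ?thesis by (simp add: prod.distrib power_sum)
  qed
  moreover have "(\<Prod>i\<in>UNIV. m i (\<beta> i)) \<le> A' ^ (sum \<beta> UNIV) * (\<Prod>i\<in>UNIV. M (\<beta> i) powr s i)" for \<beta>
  proof -
    have "(\<Prod>i\<in>UNIV. m i (\<beta> i)) \<le> (\<Prod>i\<in>UNIV. A' ^ \<beta> i * M (\<beta> i) powr s i)"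
    proof (intro prod_mono conjI)
      fix i
      have "0 \<le> A i" using aA(2)[of i] by simp
      have "m i (\<beta> i) \<le> A i ^ \<beta> i * M (\<beta> i) powr s i" by (rule aA)
      also have "\<dots> \<le> A' ^ \<beta> i * M (\<beta> i) powr s i"
        using A' \<open>0 \<le> A i\<close> by (intro mult_right_mono power_mono) auto
      finally show "m i (\<beta> i) \<le> A' ^ \<beta> i * M (\<beta> i) powr s i" .
    qed (use aA in \<open>auto simp: less_imp_le\<close>)
    then show ?thesis by (simp add: prod.distrib power_sum)
  qed
  ultimately show ?thesis using that[of a' A'] a' aA(3) by blast
qed

text \<open>The weighted data are bounded with exponent \<sigma> + s0, as the weight
  \<open>m0 n\<close> contributes s0; \<open>recurrence_bound\<close> carries this over to the
  weighted solution, and dividing by the weight returns to \<sigma>.\<close>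

lemma coeff_order_formal_solution:
  fixes M :: "nat \<Rightarrow> real" and m :: "'n::finite \<Rightarrow> nat \<Rightarrow> real" and f u :: "'n tz_series"
  assumes M: "incseq M" "\<And>n. 0 < M n" "M 0 = 1" "moderate_growth M" "star_condition M"
    and s: "\<And>i. 0 \<le> s i" "\<And>i. s i \<in> \<rat>"
    and m0: "is_seq_of_order M s0 m0" and m: "\<And>i. is_seq_of_order M (s i) (m i)"
    and \<Lambda>: "finite \<Lambda>" "\<And>j \<alpha>. (j, \<alpha>) \<in> \<Lambda> \<Longrightarrow> j < K"
    and S: "0 \<le> \<sigma> + s0" "\<sigma> + s0 \<in> \<rat>"
    and le: "\<And>j \<alpha>. (j, \<alpha>) \<in> \<Lambda> \<Longrightarrow> a j \<alpha> \<noteq> 0 \<Longrightarrow>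
      (\<Sum>i\<in>UNIV. s i * real (\<alpha> i)) \<le> (\<sigma> + s0) * (real K - real j)"
    and f: "coeff_order M \<sigma> f" and u: "formal_solution K \<Lambda> a m0 m f u"
  shows "coeff_order M \<sigma> u"
proof -
  define S where "S = \<sigma> + s0"
  define c where "c = (\<Sum>(j, \<alpha>)\<in>\<Lambda>. sum \<alpha> UNIV)"
  define L where "L = 1 + (\<Sum>(j, \<alpha>)\<in>\<Lambda>. cmod (a j \<alpha>))"
  define w where "w \<beta> = (\<Sum>i\<in>UNIV. s i * real (\<beta> i))" for \<beta>
  define V where "V \<beta> = (\<Prod>i\<in>UNIV. M (\<beta> i) powr s i)" for \<beta>
  define W where "W x n \<beta> = of_real (m0 n * (\<Prod>i\<in>UNIV. m i (\<beta> i))) * (x n \<beta> :: complex)" for x n \<beta>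
  obtain A B C where f: "0 < A" "1 \<le> B" "1 \<le> C"
    "\<And>n \<beta>. cmod (f n \<beta>) \<le> A * B ^ n * C ^ (sum \<beta> UNIV) * M n powr \<sigma>"
    using coeff_orderE[OF f] by blast
  obtain a0 A0 where m0: "0 < a0" "1 \<le> A0" "\<And>n. 0 < m0 n" "\<And>n. a0 ^ n * M n powr s0 \<le> m0 n"
    "\<And>n. m0 n \<le> A0 ^ n * M n powr s0"
    using is_seq_of_orderE[OF m0] by blast
  obtain a1 A1 where m: "0 < a1" "1 \<le> A1" "\<And>i n. 0 < m i n"
    "\<And>\<beta>. a1 ^ (sum \<beta> UNIV) * V \<beta> \<le> (\<Prod>i\<in>UNIV. m i (\<beta> i))"
    "\<And>\<beta>. (\<Prod>i\<in>UNIV. m i (\<beta> i)) \<le> A1 ^ (sum \<beta> UNIV) * V \<beta>"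
    by (rule is_seq_of_order_familyE[where m = m and s = s, OF m, folded V_def]) (rule that)
  obtain H where H: "1 \<le> H" "\<And>n k. M (n + k) \<le> H ^ (n + k) * M n * M k"
    using moderate_growthE[OF M(4,2)] by blast
  obtain h where h: "1 \<le> h" "\<And>n k. M n * M k \<le> h ^ (n + k) * M (n + k)"
    using star_conditionE[OF M(5,2)] by blast
  obtain E where "1 \<le> E" "\<forall>k \<gamma>. w \<gamma> \<le> S * real k \<longrightarrow> V \<gamma> \<le> E ^ k * M k powr S"
    using prod_powr_le_powr[where s = s, OF M s S] unfolding w_def V_def S_def by blast
  then have E: "1 \<le> E" "\<And>k \<gamma>. w \<gamma> \<le> S * real k \<Longrightarrow> V \<gamma> \<le> E ^ k * M k powr S"
    by simp_all
  define Hs where "Hs = H powr sum s UNIV"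
  have Hs: "1 \<le> Hs" unfolding Hs_def using H(1) s(1) by (intro ge_one_powr_ge_zero sum_nonneg)
  \<comment> \<open>Growth per unit of |\<beta>|: \<open>A1 * C\<close> comes from the weighted
    data, \<open>Hs\<close> from separating the shift.\<close>
  define Q where "Q = A1 * C * Hs"
  have "1 \<le> A1 * C" using f(3) m(2) mult_mono[of 1 A1 1 C] by simp
  then have Q: "1 \<le> Q" "A1 * C \<le> Q"
    unfolding Q_def using Hs mult_mono[of 1 "A1 * C" 1 Hs] mult_left_mono[of 1 Hs "A1 * C"] by auto
  define hS where "hS = h powr S"
  have hS: "1 \<le> hS" unfolding hS_def using h(1) S(1) by (intro ge_one_powr_ge_zero) (auto simp: S_def)
  have A0B: "1 \<le> A0 * B" using f(2) m0(2) mult_mono[of 1 A0 1 B] by simp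
  \<comment> \<open>Growth per unit of \<open>n\<close>: \<open>A0 * B\<close> from the weighted
    data, \<open>Q ^ c\<close> from shifts of length at most \<open>c * n\<close>, \<open>E\<close>
    from the product of powers at the shift, \<open>hS\<close> from merging two terms of
    \<open>M\<close>.\<close>
  define D where "D = A0 * B * Q ^ c * E * hS"
  have D: "0 < D" unfolding D_def using A0B Q E(1) hS by (auto intro!: mult_pos_pos)
  have V0: "0 < V \<beta>" for \<beta> unfolding V_def using M(2) by (auto intro!: prod_pos simp: less_imp_neq[symmetric])
  have L: "0 < L" unfolding L_def by (auto intro!: add_pos_nonneg sum_nonneg)

  have Wf: "cmod (W f n \<beta>) \<le> A * (A0 * B) ^ n * (A1 * C) ^ (sum \<beta> UNIV) * (M n powr S * V \<beta>)" for n \<beta>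
  proof -
    have "cmod (W f n \<beta>) = m0 n * (\<Prod>i\<in>UNIV. m i (\<beta> i)) * cmod (f n \<beta>)"
      using m0(3) m(3) by (simp add: W_def norm_mult prod_norm[symmetric] less_imp_le)
    also have "\<dots> \<le> (A0 ^ n * M n powr s0) * (A1 ^ (sum \<beta> UNIV) * V \<beta>) *
        (A * B ^ n * C ^ (sum \<beta> UNIV) * M n powr \<sigma>)"
      using m0(2,3,5) m(2,3,5) f(4) V0
      by (intro mult_mono) (auto intro!: mult_nonneg_nonneg prod_nonneg simp: less_imp_le)
    also have "\<dots> = A * (A0 * B) ^ n * (A1 * C) ^ (sum \<beta> UNIV) * (M n powr S * V \<beta>)"
      by (simp add: S_def powr_add power_mult_distrib mult_ac)
    finally show ?thesis .
  qed

  have bound: "cmod (W u n \<beta>) \<le> L ^ n * (A * D ^ n * Q ^ (sum \<beta> UNIV) * (M n powr S * V \<beta>))" for n \<beta>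
    unfolding L_def
  \<comment> \<open>The uniform bound depends only on the starting point (\<open>n\<close>,
    \<beta>), so every estimate at a reachable (n', \<beta> + \<gamma>) has to be expressed through
    \<open>n\<close> and \<beta>.\<close>
  proof (rule recurrence_bound[where w = w and S = S and c = c])
    have nz: "m0 n \<noteq> 0" "m i n \<noteq> 0" for i n
      using m0(3)[of n] m(3)[of i n] by auto
    note rec = formal_solution_recurrence[where m = m and ?m0.0 = m0, OF nz u]
    show "W u n \<beta> = 0" if "n < K" for n \<beta> using rec(1)[of n \<beta>] that by (simp only: W_def)
    show "W u (n + K) \<beta> = W f n \<beta> + (\<Sum>(j, \<alpha>)\<in>\<Lambda>. a j \<alpha> * W u (n + j) (\<lambda>i. \<beta> i + \<alpha> i))" for n \<beta>
      using rec(2)[of n \<beta>] by (simp only: W_def)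
    show "w \<alpha> \<le> S * (real K - real j)" if "(j, \<alpha>) \<in> \<Lambda>" "a j \<alpha> \<noteq> 0" for j \<alpha>
      using le[OF that] by (simp add: w_def S_def)
    show "w (\<lambda>i. \<alpha> i + \<beta> i) = w \<alpha> + w \<beta>" for \<alpha> \<beta>
      by (simp add: w_def distrib_left sum.distrib)
    show "0 \<le> S" using S by (simp add: S_def)
    show "sum \<alpha> UNIV \<le> c" if "(j, \<alpha>) \<in> \<Lambda>" for j \<alpha>
      unfolding c_def using member_le_sum[of "(j, \<alpha>)" \<Lambda> "\<lambda>(j, \<alpha>). sum \<alpha> UNIV"] that \<Lambda>(1) by simp
    show "0 \<le> A * D ^ n * Q ^ (sum \<beta> UNIV) * (M n powr S * V \<beta>)"
      using f(1) D Q V0[of \<beta>] by (intro mult_nonneg_nonneg) auto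
    fix n' \<gamma>
    assume n': "n' \<le> n" and \<gamma>: "w \<gamma> \<le> S * real (n - n')" "sum \<gamma> UNIV \<le> c * (n - n')"
    define k where "k = n - n'"
    have n: "n = n' + k" using n' by (simp add: k_def)
    let ?e = "sum \<beta> UNIV + sum \<gamma> UNIV"
    \<comment> \<open>The power of \<open>M k\<close> spent on the shift recombines with that of
      \<open>M n'\<close> by (star), leaving the single term \<open>M n\<close>.\<close>
    have MM: "M n' powr S * M k powr S \<le> hS ^ n * M n powr S"
    proof -
      have "M n' powr S * M k powr S = (M n' * M k) powr S" using M(2) by (simp add: powr_mult less_imp_le)
      also have "\<dots> \<le> (h ^ n * M n) powr S"
        using h(2)[of n' k] M(2) S(1) by (intro powr_mono2) (auto simp: n S_def less_imp_le)
      also have "\<dots> = hS ^ n * M n powr S"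
        using h(1) M(2) by (simp add: powr_mult less_imp_le hS_def powr_realpow[symmetric] powr_powr mult.commute)
      finally show ?thesis .
    qed
    have "sum \<gamma> UNIV \<le> c * n" using \<gamma>(2) by (rule order_trans) simp
    then have Qe: "Q ^ ?e \<le> Q ^ (sum \<beta> UNIV) * (Q ^ c) ^ n"
      using Q(1) by (simp add: power_mult[symmetric] power_add[symmetric] power_increasing)
    have "cmod (W f n' (\<lambda>i. \<beta> i + \<gamma> i)) \<le> A * (A0 * B) ^ n' * (A1 * C) ^ ?e * (M n' powr S * V (\<lambda>i. \<beta> i + \<gamma> i))"
      using Wf[of n' "\<lambda>i. \<beta> i + \<gamma> i"] by (simp add: sum.distrib)
    also have "\<dots> \<le> A * (A0 * B) ^ n' * (A1 * C) ^ ?e * (M n' powr S * (Hs ^ ?e * (V \<beta> * (E ^ k * M k powr S))))"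
    proof (intro mult_left_mono)
      have "V (\<lambda>i. \<beta> i + \<gamma> i) \<le> Hs ^ ?e * (V \<beta> * V \<gamma>)"
        unfolding V_def Hs_def by (rule prod_moderate_growth[OF H M(2) s(1)])
      also have "\<dots> \<le> Hs ^ ?e * (V \<beta> * (E ^ k * M k powr S))"
        using Hs E(2)[of \<gamma> k] \<gamma>(1) V0[of \<beta>] by (intro mult_left_mono) (auto simp: k_def)
      finally show "V (\<lambda>i. \<beta> i + \<gamma> i) \<le> Hs ^ ?e * (V \<beta> * (E ^ k * M k powr S))" .
    qed (use f m0(2) m(2) in auto)
    also have "\<dots> = A * V \<beta> * ((A0 * B) ^ n' * Q ^ ?e * E ^ k * (M n' powr S * M k powr S))"
      by (simp add: Q_def power_mult_distrib mult_ac)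
    also have "\<dots> \<le> A * V \<beta> * ((A0 * B) ^ n * (Q ^ (sum \<beta> UNIV) * (Q ^ c) ^ n) * E ^ n * (hS ^ n * M n powr S))"
      using f(1) V0[of \<beta>] A0B Qe MM E(1) Q(1) hS
      by (intro mult_left_mono mult_mono[OF mult_mono[OF mult_mono[OF power_increasing Qe] power_increasing] MM])
        (auto simp: n)
    also have "\<dots> = A * D ^ n * Q ^ (sum \<beta> UNIV) * (M n powr S * V \<beta>)"
      by (simp add: D_def power_mult_distrib mult_ac)
    finally show "cmod (W f n' (\<lambda>i. \<beta> i + \<gamma> i)) \<le> A * D ^ n * Q ^ (sum \<beta> UNIV) * (M n powr S * V \<beta>)" .
  qed (use \<Lambda> in auto)

  have "cmod (u n \<beta>) \<le> A * (L * D / a0) ^ n * (Q / a1) ^ (sum \<beta> UNIV) * M n powr \<sigma>" for n \<beta>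
  proof -
    \<comment> \<open>\<open>d\<close> is a lower bound for the weight. Division by it cancels
      \<open>V \<beta>\<close> and lowers the exponent of \<open>M n\<close> from S to S - s0 =
      \<sigma>.\<close>
    define d where "d = (a0 ^ n * M n powr s0) * (a1 ^ (sum \<beta> UNIV) * V \<beta>)"
    have d: "0 < d" unfolding d_def using m0(1) m(1) V0[of \<beta>] M(2)[of n] by (intro mult_pos_pos) auto
    have "d * cmod (u n \<beta>) \<le> m0 n * (\<Prod>i\<in>UNIV. m i (\<beta> i)) * cmod (u n \<beta>)"
      unfolding d_def using m0(1,3,4) m(1,3,4) V0[of \<beta>]
      by (intro mult_mono mult_right_mono) (auto intro!: mult_nonneg_nonneg prod_nonneg simp: less_imp_le)
    also have "\<dots> = cmod (W u n \<beta>)"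
      using m0(3) m(3) by (simp add: W_def norm_mult prod_norm[symmetric] less_imp_le)
    also have "\<dots> \<le> L ^ n * (A * D ^ n * Q ^ (sum \<beta> UNIV) * (M n powr S * V \<beta>))"
      by (rule bound)
    also have "\<dots> = d * (A * (L * D / a0) ^ n * (Q / a1) ^ (sum \<beta> UNIV) * M n powr \<sigma>)"
      using m0(1) m(1) by (simp add: d_def S_def powr_add power_mult_distrib power_divide mult_ac)
    finally show ?thesis using d by simp
  qed
  moreover have "0 < L * D / a0" "0 < Q / a1" using L D m0(1) m(1) Q(1) by simp_all
  ultimately show ?thesis unfolding coeff_order_def using f(1) by blast
qed

section \<open>Multivariate power series\<close>

text \<open>Any finite set of multi-indices lies in a box, over which the sum factorises into
  partial geometric sums, each at most 1 / (1 - x).\<close>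

lemma summable_on_power_sum:
  fixes x :: real
  assumes "0 \<le> x" "x < 1"
  shows "(\<lambda>\<beta>::'n::finite \<Rightarrow> nat. x ^ (sum \<beta> UNIV)) summable_on UNIV"
proof (rule nonneg_bdd_above_summable_on)
  show "bdd_above (sum (\<lambda>\<beta>::'n \<Rightarrow> nat. x ^ (sum \<beta> UNIV)) ` {F. F \<subseteq> UNIV \<and> finite F})"
  proof (rule bdd_aboveI2)
    fix F :: "('n \<Rightarrow> nat) set" assume "F \<in> {F. F \<subseteq> UNIV \<and> finite F}"
    then have F: "finite F" by simp
    then have "finite ((\<lambda>(\<beta>, i). \<beta> i) ` (F \<times> (UNIV :: 'n set)))" by simp
    then obtain k where k: "(\<lambda>(\<beta>, i). \<beta> i) ` (F \<times> (UNIV :: 'n set)) \<subseteq> {..<k}"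
      using finite_nat_iff_bounded by blast
    then have "F \<subseteq> PiE UNIV (\<lambda>_. {..<k})" by (fastforce simp: PiE_UNIV_domain)
    moreover have "finite (PiE (UNIV :: 'n set) (\<lambda>_. {..<k}))" by (intro finite_PiE) auto
    ultimately have "(\<Sum>\<beta>\<in>F. x ^ (sum \<beta> UNIV)) \<le> (\<Sum>\<beta>\<in>PiE (UNIV :: 'n set) (\<lambda>_. {..<k}). x ^ (sum \<beta> UNIV))"
      using assms by (intro sum_mono2) auto
    also have "\<dots> = (\<Prod>i\<in>(UNIV :: 'n set). \<Sum>y\<in>{..<k}. x ^ y)"
      by (subst prod_sum_PiE) (auto simp: power_sum)
    also have "\<dots> \<le> (\<Prod>i\<in>(UNIV :: 'n set). 1 / (1 - x))"
    proof (intro prod_mono conjI sum_nonneg)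
      have "(\<Sum>y<k. x ^ y) \<le> (\<Sum>y. x ^ y)"
        using assms by (intro sum_le_suminf summable_geometric) auto
      then show "(\<Sum>y<k. x ^ y) \<le> 1 / (1 - x)" using assms by (simp add: suminf_geometric)
    qed (use assms in auto)
    finally show "(\<Sum>\<beta>\<in>F. x ^ (sum \<beta> UNIV)) \<le> (\<Prod>i\<in>(UNIV :: 'n set). 1 / (1 - x))" .
  qed
qed (use assms in auto)

section \<open>Polydiscs\<close>

lemma open_polydisc: "open (polydisc R :: (complex ^ 'n::finite) set)"
proof -
  have "polydisc R = (\<Inter>i. {z :: complex ^ 'n. cmod (z $ i) < R})" by (auto simp: polydisc_def)
  then show ?thesis by (auto intro!: open_INT open_Collect_less continuous_intros)
qed

lemma convex_polydisc: "convex (polydisc R :: (complex ^ 'n::finite) set)"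
proof -
  have "polydisc R = (\<Inter>i. (\<lambda>z :: complex ^ 'n. z $ i) -` ball 0 R)" by (auto simp: polydisc_def)
  then show ?thesis
    by (auto intro!: convex_INT convex_linear_vimage bounded_linear.linear bounded_linear_vec_nth)
qed

lemma zero_in_polydisc: "0 < R \<Longrightarrow> 0 \<in> polydisc R"
  by (simp add: polydisc_def)

section \<open>Monomials and their differentials\<close>

lemma norm_monomial_le:
  fixes z :: "complex ^ 'n::finite"
  assumes "\<And>i. cmod (z $ i) \<le> r"
  shows "cmod (\<Prod>i\<in>UNIV. (z $ i) ^ \<beta> i) \<le> r ^ (sum \<beta> UNIV)"
  unfolding prod_norm[symmetric] power_sum norm_power using assms
  by (intro prod_mono) (auto intro: power_mono)

text \<open>The sum is the differential of the monomial with exponent \<beta> in direction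
  \<open>h\<close>. The factor |\<beta>| from differentiation is absorbed by 2 ^ |\<beta>|, that is,
  by doubling \<open>r\<close>.\<close>

lemma norm_monomial_derivative_le:
  fixes z h :: "complex ^ 'n::finite"
  assumes z: "\<And>i. cmod (z $ i) \<le> r" and r: "0 < r"
  shows "cmod (\<Sum>i\<in>UNIV. of_nat (\<beta> i) * h $ i * (z $ i) ^ (\<beta> i - 1) * (\<Prod>j\<in>UNIV - {i}. (z $ j) ^ \<beta> j))
    \<le> (2 * r) ^ (sum \<beta> UNIV) / r * norm h"
proof -
  have "cmod (of_nat (\<beta> i) * h $ i * (z $ i) ^ (\<beta> i - 1) * (\<Prod>j\<in>UNIV - {i}. (z $ j) ^ \<beta> j))
      \<le> real (\<beta> i) * (r ^ (sum \<beta> UNIV) / r * norm h)" for i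
  proof (cases "\<beta> i = 0")
    case False
    have "cmod (of_nat (\<beta> i) * h $ i * (z $ i) ^ (\<beta> i - 1) * (\<Prod>j\<in>UNIV - {i}. (z $ j) ^ \<beta> j))
        = real (\<beta> i) * cmod (h $ i) * cmod (z $ i) ^ (\<beta> i - 1) * (\<Prod>j\<in>UNIV - {i}. cmod (z $ j) ^ \<beta> j)"
      by (simp add: norm_mult norm_power prod_norm[symmetric])
    also have "\<dots> \<le> real (\<beta> i) * norm h * r ^ (\<beta> i - 1) * (\<Prod>j\<in>UNIV - {i}. r ^ \<beta> j)"
      using z r by (intro mult_mono power_mono prod_mono)
        (auto intro!: power_mono prod_nonneg mult_nonneg_nonneg Finite_Cartesian_Product.norm_nth_le)
    also have "\<dots> = real (\<beta> i) * norm h * (r ^ (\<beta> i - 1) * r ^ (\<Sum>j\<in>UNIV - {i}. \<beta> j))"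
      by (simp add: power_sum)
    also have "r ^ (\<beta> i - 1) * r ^ (\<Sum>j\<in>UNIV - {i}. \<beta> j) = r ^ (sum \<beta> UNIV) / r"
    proof -
      have "sum \<beta> UNIV = Suc ((\<beta> i - 1) + (\<Sum>j\<in>UNIV - {i}. \<beta> j))"
        using False sum.remove[of UNIV i \<beta>] by simp
      then show ?thesis using r by (simp add: power_add)
    qed
    finally show ?thesis by (simp add: mult_ac)
  qed simp
  then have "cmod (\<Sum>i\<in>UNIV. of_nat (\<beta> i) * h $ i * (z $ i) ^ (\<beta> i - 1) * (\<Prod>j\<in>UNIV - {i}. (z $ j) ^ \<beta> j))
      \<le> (\<Sum>i\<in>UNIV. real (\<beta> i) * (r ^ (sum \<beta> UNIV) / r * norm h))"
    by (intro sum_norm_le) auto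
  also have "\<dots> = real (sum \<beta> UNIV) * (r ^ (sum \<beta> UNIV) / r * norm h)"
    by (simp only: sum_distrib_right[symmetric] of_nat_sum)
  also have "\<dots> \<le> 2 ^ (sum \<beta> UNIV) * (r ^ (sum \<beta> UNIV) / r * norm h)"
    using r of_nat_less_two_power[of "sum \<beta> UNIV", where 'a = real]
    by (intro mult_right_mono) (simp_all add: less_imp_le)
  finally show ?thesis by (simp add: power_mult_distrib)
qed

text \<open>Enumerating the multi-indices makes term-by-term differentiation of ordinary series
  available; the constant multi-indices show that there are infinitely many.\<close>

lemma bij_from_nat_into_fun: "bij (from_nat_into (UNIV :: ('n::finite \<Rightarrow> nat) set))"
proof -
  have "inj (\<lambda>k (_::'n). k :: nat)" by (auto simp: inj_def fun_eq_iff)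
  then have "infinite (UNIV :: ('n \<Rightarrow> nat) set)"
    using finite_subset[OF subset_UNIV] range_inj_infinite by blast
  then show ?thesis by (intro bij_betw_from_nat_into) auto
qed

text \<open>With C * \<rho> = 1/4 the terms are dominated by powers of 1/4, and their differentials,
  despite the doubled radius, still by powers of 1/2.\<close>

lemma multi_power_series:
  fixes c :: "'n::finite z_series"
  assumes c: "\<And>\<beta>. cmod (c \<beta>) \<le> A * C ^ (sum \<beta> UNIV)" and C: "0 < C"
  defines "G \<equiv> \<lambda>z :: complex ^ 'n. \<Sum>\<^sub>\<infinity>\<beta>. c \<beta> * (\<Prod>i\<in>UNIV. (z $ i) ^ \<beta> i)"
    and "\<rho> \<equiv> 1 / (4 * C)"
  shows "represents_on c G (polydisc \<rho>)" and "multi_holomorphic_on G (polydisc \<rho>)"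
    and "\<And>z. z \<in> polydisc \<rho> \<Longrightarrow> cmod (G z) \<le> A * (\<Sum>\<^sub>\<infinity>\<beta>::'n \<Rightarrow> nat. (1 / 4) ^ (sum \<beta> UNIV))"
proof -
  have \<rho>: "0 < \<rho>" using C by (simp add: \<rho>_def)
  have C\<rho>: "C * \<rho> = 1 / 4" using C by (simp add: \<rho>_def)
  have "0 \<le> A" using order_trans[OF norm_ge_zero c[of "\<lambda>_. 0"]] by simp
  have le: "cmod (c \<beta> * (\<Prod>i\<in>UNIV. (z $ i) ^ \<beta> i)) \<le> A * (1 / 4) ^ (sum \<beta> UNIV)"
    if "z \<in> polydisc \<rho>" for z \<beta>
  proof -
    have "cmod (c \<beta> * (\<Prod>i\<in>UNIV. (z $ i) ^ \<beta> i)) \<le> A * C ^ (sum \<beta> UNIV) * \<rho> ^ (sum \<beta> UNIV)"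
      unfolding norm_mult using that c \<open>0 \<le> A\<close> C
      by (intro mult_mono norm_monomial_le) (auto simp: polydisc_def less_imp_le)
    then show ?thesis by (simp add: C\<rho>[symmetric] power_mult_distrib mult_ac)
  qed
  have sm: "(\<lambda>\<beta>::'n \<Rightarrow> nat. A * (1 / 4) ^ (sum \<beta> UNIV)) summable_on UNIV"
    by (intro summable_on_cmult_right summable_on_power_sum) auto
  have hs: "((\<lambda>\<beta>. c \<beta> * (\<Prod>i\<in>UNIV. (z $ i) ^ \<beta> i)) has_sum G z) UNIV" if "z \<in> polydisc \<rho>" for z
    unfolding G_def
    by (rule has_sum_infsum, rule abs_summable_summable)
      (rule summable_on_comparison_test[OF sm le[OF that] norm_ge_zero])
  then show "represents_on c G (polydisc \<rho>)" by (simp add: represents_on_def)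
  show "cmod (G z) \<le> A * (\<Sum>\<^sub>\<infinity>\<beta>::'n \<Rightarrow> nat. (1 / 4) ^ (sum \<beta> UNIV))" if "z \<in> polydisc \<rho>" for z
    by (rule norm_infsum_le[OF hs[OF that] _ le[OF that]])
      (intro has_sum_cmult_right has_sum_infsum summable_on_power_sum, simp_all)

  define e where "e = from_nat_into (UNIV :: ('n \<Rightarrow> nat) set)"
  have e: "bij e" unfolding e_def by (rule bij_from_nat_into_fun)
  define F where "F k z = c (e k) * (\<Prod>i\<in>UNIV. (z $ i) ^ e k i)" for k and z :: "complex ^ 'n"
  define F' where "F' k z h = c (e k) * (\<Sum>i\<in>UNIV. of_nat (e k i) * h $ i * (z $ i) ^ (e k i - 1) *
    (\<Prod>j\<in>UNIV - {i}. (z $ j) ^ e k j))" for k and z h :: "complex ^ 'n"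
  define b where "b k = A / \<rho> * (1 / 2) ^ (sum (e k) UNIV)" for k
  have F'_le: "cmod (F' k z h) \<le> b k * norm h" if "z \<in> polydisc \<rho>" for k z h
  proof -
    have "cmod (F' k z h) \<le> A * C ^ (sum (e k) UNIV) * ((2 * \<rho>) ^ (sum (e k) UNIV) / \<rho> * norm h)"
      unfolding F'_def norm_mult using that c \<rho> \<open>0 \<le> A\<close> C
      by (intro mult_mono norm_monomial_derivative_le) (auto simp: polydisc_def less_imp_le)
    also have "\<dots> = A / \<rho> * (2 * (C * \<rho>)) ^ (sum (e k) UNIV) * norm h"
      by (simp add: power_mult_distrib mult_ac)
    finally show ?thesis by (simp add: b_def C\<rho>)
  qed
  have "(\<lambda>\<beta>::'n \<Rightarrow> nat. A / \<rho> * (1 / 2) ^ (sum \<beta> UNIV)) summable_on UNIV"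
    by (intro summable_on_cmult_right summable_on_power_sum) auto
  then have "b summable_on UNIV"
    unfolding b_def using summable_on_reindex_bij_betw[OF e, of "\<lambda>\<beta>. A / \<rho> * (1 / 2) ^ (sum \<beta> UNIV)"] by simp
  then have b: "summable b" by (rule summable_on_imp_summable)
  have b0: "0 \<le> b k" for k using \<open>0 \<le> A\<close> \<rho> by (simp add: b_def)
  have sF': "summable (\<lambda>k. F' k z h)" if "z \<in> polydisc \<rho>" for z h
    by (rule summable_comparison_test'[OF summable_mult2[OF b, of "norm h"], of 0]) (rule F'_le[OF that])
  define g' where "g' z h = (\<Sum>k. F' k z h)" for z h
  \<comment> \<open>The tails of the differentiated series are small uniformly in \<open>z\<close>
    and relative to the norm of \<open>h\<close>, as termwise differentiation requires.\<close>
  have ev: "\<forall>\<^sub>F n in sequentially. \<forall>z\<in>polydisc \<rho>. \<forall>h. norm ((\<Sum>k<n. F' k z h) - g' z h) \<le> \<epsilon> * norm h"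
    if "\<epsilon> > 0" for \<epsilon>
  proof -
    obtain n0 where n0: "\<And>n. n \<ge> n0 \<Longrightarrow> norm (\<Sum>k. b (k + n)) < \<epsilon>"
      using suminf_exist_split[OF \<open>\<epsilon> > 0\<close> b] by blast
    have "norm ((\<Sum>k<n. F' k z h) - g' z h) \<le> \<epsilon> * norm h" if "n \<ge> n0" "z \<in> polydisc \<rho>" for n z h
    proof -
      have bs: "summable (\<lambda>k. b (k + n) * norm h)"
        by (intro summable_mult2 summable_ignore_initial_segment b)
      have "g' z h = (\<Sum>k. F' (k + n) z h) + (\<Sum>k<n. F' k z h)"
        unfolding g'_def by (rule suminf_split_initial_segment[OF sF'[OF that(2)]])
      then have "norm ((\<Sum>k<n. F' k z h) - g' z h) = norm (\<Sum>k. F' (k + n) z h)" by simp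
      also have "\<dots> \<le> (\<Sum>k. b (k + n) * norm h)"
        by (rule norm_suminf_le[OF F'_le[OF that(2)] bs])
      also have "\<dots> = (\<Sum>k. b (k + n)) * norm h"
        by (rule suminf_mult2[symmetric]) (intro summable_ignore_initial_segment b)
      also have "\<dots> \<le> \<epsilon> * norm h" using n0[OF that(1)] by (intro mult_right_mono) auto
      finally show ?thesis .
    qed
    then show ?thesis unfolding eventually_sequentially by blast
  qed
  have sums: "(\<lambda>k. F k z) sums G z" if "z \<in> polydisc \<rho>" for z
    unfolding F_def using hs[OF that] has_sum_reindex_bij_betw[OF e, of "\<lambda>\<beta>. c \<beta> * (\<Prod>i\<in>UNIV. (z $ i) ^ \<beta> i)"]
    by (intro has_sum_imp_sums) auto
  have dF: "(F k has_derivative F' k z) (at z within polydisc \<rho>)" for k z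
    unfolding F_def[abs_def] F'_def[abs_def]
    by (intro has_derivative_mult_right has_derivative_prod has_derivative_power
      bounded_linear.has_derivative[OF bounded_linear_vec_nth] has_derivative_ident)
  obtain g where g: "\<forall>z\<in>polydisc \<rho>. (\<lambda>k. F k z) sums g z \<and> (g has_derivative g' z) (at z within polydisc \<rho>)"
    using has_derivative_series[OF convex_polydisc dF ev zero_in_polydisc[OF \<rho>] sums[OF zero_in_polydisc[OF \<rho>]]]
    by blast
  \<comment> \<open>Termwise differentiation only yields some limit function \<open>g\<close>;
    uniqueness of sums identifies it with \<open>G\<close>.\<close>
  have gG: "g z = G z" if "z \<in> polydisc \<rho>" for z
    using g sums[OF that] that sums_unique2 by blast
  show "multi_holomorphic_on G (polydisc \<rho>)"
    unfolding multi_holomorphic_on_def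
  proof (intro ballI exI conjI allI)
    fix z :: "complex ^ 'n" assume z: "z \<in> polydisc \<rho>"
    have "(g has_derivative g' z) (at z within polydisc \<rho>)" using g z by blast
    then have "(g has_derivative g' z) (at z)" unfolding at_within_open[OF z open_polydisc] .
    then show "(G has_derivative g' z) (at z)"
      by (rule has_derivative_transform_within_open[OF _ open_polydisc z gG])
    fix a :: complex and v
    \<comment> \<open>The derivative obtained is a priori only real-linear; complex homogeneity
      holds for each term and passes to the sum.\<close>
    have "F' k z (a *s v) = a * F' k z v" for k
      by (simp add: F'_def sum_distrib_left mult_ac)
    then show "g' z (a *s v) = a * g' z v"
      unfolding g'_def using suminf_mult[OF sF'[OF z]] by simp
  qed
qed

text \<open>As \<open>C\<close> does not depend on \<open>n\<close>, all coefficient series converge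
  on one polydisc, and the amplitude \<open>A * B ^ n * M n powr s\<close> passes to the
  sums.\<close>

lemma coeff_order_imp_has_order:
  fixes g :: "'n::finite tz_series"
  assumes "coeff_order M s g"
  shows "has_order M s g"
proof -
  obtain A B C where ABC: "0 < A" "1 \<le> B" "1 \<le> C"
    "\<And>n \<beta>. cmod (g n \<beta>) \<le> A * B ^ n * C ^ (sum \<beta> UNIV) * M n powr s"
    using coeff_orderE[OF assms] by blast
  define G where "G n z = (\<Sum>\<^sub>\<infinity>\<beta>. g n \<beta> * (\<Prod>i\<in>UNIV. (z $ i) ^ \<beta> i))" for n and z :: "complex ^ 'n"
  define T where "T = (\<Sum>\<^sub>\<infinity>\<beta>::'n \<Rightarrow> nat. (1 / 4 :: real) ^ (sum \<beta> UNIV))"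
  define \<rho> where "\<rho> = 1 / (4 * C)"
  have "0 \<le> T" unfolding T_def by (intro infsum_nonneg) auto
  have g: "cmod (g n \<beta>) \<le> (A * B ^ n * M n powr s) * C ^ (sum \<beta> UNIV)" for n \<beta>
    using ABC(4)[of n \<beta>] by (simp add: mult_ac)
  have C: "0 < C" using ABC(3) by simp
  note G = multi_power_series[of "g n" for n, OF g C, folded G_def \<rho>_def T_def]
  have "cmod (G n z) \<le> (A * (T + 1)) * B ^ n * M n powr s" if "z \<in> polydisc r" "r < \<rho>" for n z r
  proof -
    have "z \<in> polydisc \<rho>" using that by (auto simp: polydisc_def intro: less_trans)
    then have "cmod (G n z) \<le> (A * B ^ n * M n powr s) * T" by (rule G(3))
    \<comment> \<open>\<open>T + 1\<close> makes the constant strictly positive from T \<ge> 0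
      alone.\<close>
    also have "\<dots> \<le> (A * B ^ n * M n powr s) * (T + 1)" using ABC by (intro mult_left_mono) auto
    finally show ?thesis by (simp add: mult_ac)
  qed
  moreover have "0 < A * (T + 1)" "0 < B" "0 < \<rho>" using ABC \<open>0 \<le> T\<close> by (auto simp: \<rho>_def)
  ultimately show ?thesis unfolding has_order_def using G(1,2) by blast
qed

section \<open>Cauchy estimates\<close>

lemma has_sum_sum_family:
  fixes g :: "'b \<Rightarrow> 'a \<Rightarrow> 'c :: topological_comm_monoid_add"
  assumes "finite X" "\<And>x. x \<in> X \<Longrightarrow> (g x has_sum S x) A"
  shows "((\<lambda>b. \<Sum>x\<in>X. g x b) has_sum (\<Sum>x\<in>X. S x)) A"
  using assms by (induction X rule: finite_induct) (auto intro: has_sum_add)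

text \<open>Orthogonality of the characters of the integers modulo \<open>Q\<close>: the sum is
  geometric with a ratio that is a \<open>Q\<close>-th root of unity.\<close>

lemma sum_root_of_unity_powers:
  fixes Q k :: nat
  assumes "0 < Q"
  defines "\<omega> \<equiv> exp (2 * of_real pi * \<i> / of_nat Q)"
  shows "(\<Sum>y<Q. (\<omega> ^ y) ^ k) = (if Q dvd k then of_nat Q else 0)"
proof -
  have \<omega>k: "\<omega> ^ k = exp (2 * of_real pi * \<i> * of_nat k / of_nat Q)" for k
    unfolding \<omega>_def exp_of_nat_mult[symmetric] by (simp add: mult_ac)
  have one: "\<omega> ^ k = 1 \<longleftrightarrow> Q dvd k" for k
    unfolding \<omega>k using complex_root_unity_eq_1[of Q k] assms(1) by simp
  have "(\<Sum>y<Q. (\<omega> ^ y) ^ k) = (\<Sum>y<Q. (\<omega> ^ k) ^ y)"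
    by (simp add: power_mult[symmetric] mult.commute)
  also have "\<dots> = (if Q dvd k then of_nat Q else 0)"
  proof (cases "Q dvd k")
    case False
    have "(\<omega> ^ k) ^ Q = 1" unfolding power_mult[symmetric] one by simp
    moreover have "\<omega> ^ k \<noteq> 1" using False one by simp
    ultimately show ?thesis using False by (simp add: geometric_sum)
  next
    case True
    then have "\<omega> ^ k = 1" using one by simp
    then show ?thesis using True by simp
  qed
  finally show ?thesis .
qed

text \<open>
  Averaging \<open>G\<close> over the points whose coordinates are \<open>\<rho>\<close> times \<open>Q\<close>-th roots of unity, against
  the character of \<open>\<beta>\<close>, leaves exactly the coefficients congruent to \<open>\<beta>\<close> modulo \<open>Q\<close>.
\<close>
lemma coefficient_average:
  fixes c :: "'n::finite z_series"
  assumes rep: "represents_on c G (polydisc r)" and \<rho>: "0 < \<rho>" "\<rho> < r"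
    and G: "\<And>z. z \<in> polydisc r \<Longrightarrow> cmod (G z) \<le> X" and \<beta>: "\<And>i. \<beta> i < Q"
  shows "\<exists>V. cmod V \<le> X \<and>
    ((\<lambda>\<gamma>. if \<forall>i. \<gamma> i mod Q = \<beta> i then c \<gamma> * of_real \<rho> ^ (sum \<gamma> UNIV) else 0) has_sum V) UNIV"
proof -
  define \<omega> where "\<omega> = exp (2 * of_real pi * \<i> / of_nat Q)"
  have Q: "0 < Q" using \<beta>[of undefined] by simp
  have \<omega>: "cmod \<omega> = 1" unfolding \<omega>_def by (simp add: norm_exp_eq_Re)
  define Y where "Y = PiE (UNIV :: 'n set) (\<lambda>_. {..<Q})"
  have finY: "finite Y" unfolding Y_def by (intro finite_PiE) auto
  have cardY: "card Y = Q ^ CARD('n)" unfolding Y_def by (simp add: card_PiE)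
  define z where "z y = (\<chi> i. of_real \<rho> * \<omega> ^ y i)" for y :: "'n \<Rightarrow> nat"
  have z: "z y \<in> polydisc r" for y
    using \<rho> \<omega> by (simp add: z_def polydisc_def norm_mult norm_power)
  \<comment> \<open>The conjugate character: modulo \<open>Q\<close>, the exponent
    \<open>Q - \<beta> i\<close> stands for the negative of \<open>\<beta> i\<close>.\<close>
  define ch where "ch y = (\<Prod>i\<in>UNIV. (\<omega> ^ y i) ^ (Q - \<beta> i))" for y :: "'n \<Rightarrow> nat"
  have ch: "cmod (ch y) = 1" for y by (simp add: ch_def prod_norm[symmetric] norm_power \<omega>)
  define V where "V = (\<Sum>y\<in>Y. ch y * G (z y)) / of_nat Q ^ CARD('n)"
  have "cmod (\<Sum>y\<in>Y. ch y * G (z y)) \<le> (\<Sum>y\<in>Y. X)"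
    by (intro sum_norm_le) (simp add: norm_mult ch G z)
  then have "cmod V \<le> X"
    using Q by (simp add: V_def norm_divide norm_power cardY field_simps)
  have "((\<lambda>\<gamma>. \<Sum>y\<in>Y. ch y * (c \<gamma> * (\<Prod>i\<in>UNIV. (z y $ i) ^ \<gamma> i))) has_sum (\<Sum>y\<in>Y. ch y * G (z y))) UNIV"
  proof (rule has_sum_sum_family[OF finY])
    fix y
    have "((\<lambda>\<gamma>. c \<gamma> * (\<Prod>i\<in>UNIV. (z y $ i) ^ \<gamma> i)) has_sum G (z y)) UNIV"
      using rep z[of y] unfolding represents_on_def by (rule bspec)
    then show "((\<lambda>\<gamma>. ch y * (c \<gamma> * (\<Prod>i\<in>UNIV. (z y $ i) ^ \<gamma> i))) has_sum ch y * G (z y)) UNIV"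
      by (rule has_sum_cmult_right)
  qed
  from has_sum_cmult_left[OF this, of "inverse (of_nat Q ^ CARD('n))"]
  have "((\<lambda>\<gamma>. (\<Sum>y\<in>Y. ch y * (c \<gamma> * (\<Prod>i\<in>UNIV. (z y $ i) ^ \<gamma> i))) * inverse (of_nat Q ^ CARD('n))) has_sum V) UNIV"
    by (simp only: V_def divide_inverse)
  also have "(\<lambda>\<gamma>. (\<Sum>y\<in>Y. ch y * (c \<gamma> * (\<Prod>i\<in>UNIV. (z y $ i) ^ \<gamma> i))) * inverse (of_nat Q ^ CARD('n))) =
      (\<lambda>\<gamma>. if \<forall>i. \<gamma> i mod Q = \<beta> i then c \<gamma> * of_real \<rho> ^ (sum \<gamma> UNIV) else 0)"
  proof
    fix \<gamma>
    have dvd: "Q dvd \<gamma> i + (Q - \<beta> i) \<longleftrightarrow> \<gamma> i mod Q = \<beta> i" for i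
    proof -
      have "Q dvd \<gamma> i + (Q - \<beta> i) \<longleftrightarrow> int Q dvd int (\<gamma> i) - int (\<beta> i) + int Q"
        using \<beta>[of i] by (simp add: of_nat_diff algebra_simps flip: int_dvd_int_iff)
      also have "\<dots> \<longleftrightarrow> int (\<gamma> i) mod int Q = int (\<beta> i) mod int Q"
        by (simp add: mod_eq_dvd_iff)
      also have "\<dots> \<longleftrightarrow> \<gamma> i mod Q = \<beta> i"
        using \<beta>[of i] by (simp flip: zmod_int)
      finally show ?thesis .
    qed
    have "ch y * (c \<gamma> * (\<Prod>i\<in>UNIV. (z y $ i) ^ \<gamma> i)) =
        c \<gamma> * of_real \<rho> ^ (sum \<gamma> UNIV) * (\<Prod>i\<in>UNIV. (\<omega> ^ y i) ^ (\<gamma> i + (Q - \<beta> i)))" for y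
      by (simp add: ch_def z_def power_mult_distrib power_add prod.distrib power_sum mult_ac)
    then have "(\<Sum>y\<in>Y. ch y * (c \<gamma> * (\<Prod>i\<in>UNIV. (z y $ i) ^ \<gamma> i))) =
        c \<gamma> * of_real \<rho> ^ (sum \<gamma> UNIV) * (\<Sum>y\<in>Y. \<Prod>i\<in>UNIV. (\<omega> ^ y i) ^ (\<gamma> i + (Q - \<beta> i)))"
      by (simp only: sum_distrib_left)
    also have "(\<Sum>y\<in>Y. \<Prod>i\<in>UNIV. (\<omega> ^ y i) ^ (\<gamma> i + (Q - \<beta> i))) =
        (\<Prod>i\<in>UNIV. \<Sum>x<Q. (\<omega> ^ x) ^ (\<gamma> i + (Q - \<beta> i)))"
      unfolding Y_def by (rule prod_sum_PiE[symmetric]) auto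
    also have "\<dots> = (\<Prod>i\<in>UNIV. if \<gamma> i mod Q = \<beta> i then of_nat Q else 0)"
      unfolding \<omega>_def sum_root_of_unity_powers[OF Q] dvd ..
    also have "\<dots> = (if \<forall>i. \<gamma> i mod Q = \<beta> i then of_nat Q ^ CARD('n) else 0)"
      by (auto simp: prod_zero_iff)
    finally show "(\<Sum>y\<in>Y. ch y * (c \<gamma> * (\<Prod>i\<in>UNIV. (z y $ i) ^ \<gamma> i))) * inverse (of_nat Q ^ CARD('n)) =
        (if \<forall>i. \<gamma> i mod Q = \<beta> i then c \<gamma> * of_real \<rho> ^ (sum \<gamma> UNIV) else 0)"
      using Q by simp
  qed
  finally show ?thesis using \<open>cmod V \<le> X\<close> by blast
qed

text \<open>A finite average over roots of unity replaces the Cauchy integral. It isolates the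
  coefficient at \<beta> up to aliased terms at indices congruent to \<beta> modulo
  \<open>Q\<close>; for large \<open>Q\<close> these fall outside a finite set carrying the absolute
  sum up to \<epsilon>.\<close>

lemma cauchy_coefficient_estimate:
  fixes c :: "'n::finite z_series"
  assumes rep: "represents_on c G (polydisc r)" and \<rho>: "0 < \<rho>" "\<rho> < r"
    and G: "\<And>z. z \<in> polydisc r \<Longrightarrow> cmod (G z) \<le> X"
  shows "cmod (c \<beta>) * \<rho> ^ (sum \<beta> UNIV) \<le> X"
proof (rule field_le_epsilon)
  fix \<epsilon> :: real assume \<epsilon>: "0 < \<epsilon>"
  define t where "t \<gamma> = c \<gamma> * of_real \<rho> ^ (sum \<gamma> UNIV)" for \<gamma>
  have "(\<chi> i. of_real \<rho>) \<in> polydisc r" using \<rho> by (simp add: polydisc_def)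
  then have "(\<lambda>\<alpha>. c \<alpha> * (\<Prod>i\<in>UNIV. ((\<chi> i. of_real \<rho>) $ i) ^ \<alpha> i)) summable_on UNIV"
    using rep unfolding represents_on_def summable_on_def by blast
  then have "t summable_on UNIV" by (simp add: t_def[abs_def] power_sum)
  then have sm: "(\<lambda>\<gamma>. cmod (t \<gamma>)) summable_on UNIV"
    by (simp add: summable_on_iff_abs_summable_on_complex)
  then obtain F where F: "finite F" "dist (sum (\<lambda>\<gamma>. cmod (t \<gamma>)) F) (\<Sum>\<^sub>\<infinity>\<gamma>. cmod (t \<gamma>)) \<le> \<epsilon>"
    using has_sum_finite_approximation[OF has_sum_infsum \<epsilon>] by blast
  define T where "T = (\<Sum>\<^sub>\<infinity>\<gamma>. cmod (t \<gamma>)) - sum (\<lambda>\<gamma>. cmod (t \<gamma>)) F"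
  have T: "((\<lambda>\<gamma>. cmod (t \<gamma>)) has_sum T) (UNIV - F)"
    unfolding T_def using sm F(1) by (intro has_sum_Diff has_sum_infsum has_sum_finite) auto
  have T\<epsilon>: "T \<le> \<epsilon>" using F(2) unfolding T_def dist_real_def by linarith
  have "finite ((\<lambda>(\<gamma>, i). \<gamma> i) ` (insert \<beta> F \<times> (UNIV :: 'n set)))" using F(1) by simp
  \<comment> \<open>\<open>Q\<close> exceeds all entries of \<beta> and of the members of
    \<open>F\<close>, so none of these other than \<beta> is congruent to \<beta>.\<close>
  then obtain Q where Q: "(\<lambda>(\<gamma>, i). \<gamma> i) ` (insert \<beta> F \<times> (UNIV :: 'n set)) \<subseteq> {..<Q}"
    using finite_nat_iff_bounded by blast
  then have FQ: "\<gamma> i < Q" if "\<gamma> \<in> insert \<beta> F" for \<gamma> i using that by fastforce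
  define q where "q \<gamma> = (if \<forall>i. \<gamma> i mod Q = \<beta> i then t \<gamma> else 0)" for \<gamma>
  obtain V where V: "cmod V \<le> X" "(q has_sum V) UNIV"
    using coefficient_average[OF rep \<rho> G, of \<beta> Q] FQ unfolding q_def t_def by blast
  have "q \<beta> = t \<beta>" using FQ by (simp add: q_def)
  then have "(q has_sum (V - t \<beta>)) (UNIV - {\<beta>})"
    using V(2) by (intro has_sum_Diff) (auto intro: has_sum_finiteI)
  moreover have "q \<gamma> = 0" if "\<gamma> \<in> F" "\<gamma> \<noteq> \<beta>" for \<gamma>
    using that FQ[of \<gamma>] by (auto simp: q_def fun_eq_iff)
  \<comment> \<open>\<beta> itself may lie outside \<open>F\<close>, hence its term is replaced by
    0; inside \<open>F\<close> all other terms of \<open>q\<close> vanish, so both domains give the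
    same sum.\<close>
  ultimately have "((\<lambda>\<gamma>. if \<gamma> = \<beta> then 0 else q \<gamma>) has_sum (V - t \<beta>)) (UNIV - F)"
    by (subst has_sum_cong_neutral[where T = "UNIV - {\<beta>}" and g = q]) auto
  then have "cmod (V - t \<beta>) \<le> T"
    by (rule norm_infsum_le[OF _ T]) (auto simp: q_def)
  then have "cmod (t \<beta>) \<le> X + \<epsilon>"
    using V(1) T\<epsilon> norm_triangle_ineq4[of V "V - t \<beta>"] by simp
  then show "cmod (c \<beta>) * \<rho> ^ (sum \<beta> UNIV) \<le> X + \<epsilon>"
    using \<rho> by (simp add: t_def norm_mult norm_power)
qed

text \<open>Cauchy's estimate with radius R/4 inside the polydisc of radius R/2, where a bound
  uniform in \<open>z\<close> is available; neither radius depends on \<open>n\<close>.\<close>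

lemma has_order_imp_coeff_order:
  fixes g :: "'n::finite tz_series"
  assumes "has_order M s g"
  shows "coeff_order M s g"
proof -
  obtain R G where R: "0 < R" "\<And>n. represents_on (g n) (G n) (polydisc R)"
    "\<And>r. 0 < r \<Longrightarrow> r < R \<Longrightarrow> \<exists>A>0. \<exists>B>0. \<forall>n. \<forall>z\<in>polydisc r. cmod (G n z) \<le> A * B ^ n * M n powr s"
    using assms unfolding has_order_def by blast
  define r \<rho> where "r = R / 2" and "\<rho> = R / 4"
  have r: "0 < \<rho>" "\<rho> < r" "r < R" using R(1) by (auto simp: r_def \<rho>_def)
  obtain A B where AB: "0 < A" "0 < B" "\<And>n z. z \<in> polydisc r \<Longrightarrow> cmod (G n z) \<le> A * B ^ n * M n powr s"
    using R(3)[of r] r by auto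
  have "polydisc r \<subseteq> polydisc R" using r(3) by (auto simp: polydisc_def intro: less_trans)
  then have rep: "represents_on (g n) (G n) (polydisc r)" for n
    using R(2)[of n] unfolding represents_on_def by blast
  have "cmod (g n \<beta>) \<le> A * B ^ n * (1 / \<rho>) ^ (sum \<beta> UNIV) * M n powr s" for n \<beta>
    using cauchy_coefficient_estimate[OF rep r(1,2) AB(3), of n \<beta>] r(1)
    by (simp add: power_one_over field_simps)
  then show ?thesis unfolding coeff_order_def using AB(1,2) r(1)
    by (intro exI[of _ A] exI[of _ B] exI[of _ "1 / \<rho>"] conjI) auto
qed

section \<open>The order of the formal solution\<close>

theorem theorem3:
  fixes M :: "nat \<Rightarrow> real"
    and m0 :: "nat \<Rightarrow> real" and m :: "'n::finite \<Rightarrow> nat \<Rightarrow> real"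
    and s0 :: real and s :: "'n \<Rightarrow> real"
    and K :: nat and \<Lambda> :: "(nat \<times> ('n \<Rightarrow> nat)) set"
    and a :: "nat \<Rightarrow> ('n \<Rightarrow> nat) \<Rightarrow> complex"
    and k1 :: real and f u :: "'n tz_series"
  assumes "K \<ge> 1"
    and "incseq M" and "\<And>n. M n > 0" and "M 0 = 1"
    and "moderate_growth M" and "star_condition M"
    and "s0 \<ge> 0" and "\<And>i. s i \<ge> 0" and "\<And>i. s i \<in> \<rat>"
    and "is_seq_of_order M s0 m0" and "\<And>i. is_seq_of_order M (s i) (m i)"
    and "finite \<Lambda>" and "\<And>j \<alpha>. (j, \<alpha>) \<in> \<Lambda> \<Longrightarrow> j < K"
    and "is_first_positive_slope (newton_polygon K \<Lambda> a s0 s) k1" and "1 / k1 > 0"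
    and "has_order M (1 / k1) f"
    and "formal_solution K \<Lambda> a m0 m f u"
  shows "has_order M (1 / k1) u"
proof -
  define \<sigma> where "\<sigma> = 1 / k1"
  define q where "q = (\<lambda>(j, \<alpha>). (s0 * (real j - real K) + (\<Sum>i\<in>UNIV. s i * real (\<alpha> i))) / (real K - real j))"
  define L where "L = {(j, \<alpha>) \<in> \<Lambda>. a j \<alpha> \<noteq> 0}"
  have finL: "finite L" using assms(12) by (rule finite_subset[rotated]) (auto simp: L_def)
  have "\<sigma> = inverse_first_slope K \<Lambda> a s0 s"
    using is_first_positive_slope_newton_polygon_iff[OF assms(12,13)] assms(14) by (simp add: \<sigma>_def)
  then have \<sigma>: "\<sigma> = Max (insert 0 (q ` L))"
    by (simp add: inverse_first_slope_def q_def L_def)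
  have q: "q (j, \<alpha>) = (\<Sum>i\<in>UNIV. s i * real (\<alpha> i)) / (real K - real j) - s0" if "j < K" for j \<alpha>
    using that by (simp add: q_def field_simps)
  have "\<sigma> \<in> insert 0 (q ` L)" unfolding \<sigma> using finL by (intro Max_in) auto
  \<comment> \<open>Positivity of \<sigma> excludes the value 0, so the maximum is attained at an
    element of \<Lambda>.\<close>
  then obtain j \<alpha> where j\<alpha>: "(j, \<alpha>) \<in> \<Lambda>" "\<sigma> = q (j, \<alpha>)"
    using assms(15) unfolding \<sigma>_def[symmetric] by (auto simp: L_def)
  then have "\<sigma> + s0 = (\<Sum>i\<in>UNIV. s i * real (\<alpha> i)) / (real K - real j)"
    using q assms(13) by simp
  also have "\<dots> \<in> \<rat>"
    using assms(9) by (intro Rats_divide Rats_diff Rats_of_nat Rats_sum Rats_mult)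
  finally have rat: "\<sigma> + s0 \<in> \<rat>" .
  have "0 \<le> \<sigma> + s0" using assms(7,15) by (simp add: \<sigma>_def)
  \<comment> \<open>Maximality of \<sigma>, cleared of the positive denominator K - j.\<close>
  have le: "(\<Sum>i\<in>UNIV. s i * real (\<alpha> i)) \<le> (\<sigma> + s0) * (real K - real j)"
    if "(j, \<alpha>) \<in> \<Lambda>" "a j \<alpha> \<noteq> 0" for j \<alpha>
  proof -
    have jK: "j < K" using assms(13) that by blast
    have "q (j, \<alpha>) \<le> \<sigma>" unfolding \<sigma> using finL that by (intro Max_ge) (auto simp: L_def)
    then show ?thesis unfolding q[OF jK] using jK by (simp add: field_simps)
  qed
  have "coeff_order M \<sigma> u"
    by (rule coeff_order_formal_solution[where s = s and m = m and ?m0.0 = m0, OF assms(2-6,8-13)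
      \<open>0 \<le> \<sigma> + s0\<close> rat le has_order_imp_coeff_order assms(17)]) (use assms(16) in \<open>simp_all add: \<sigma>_def\<close>)
  then show ?thesis unfolding \<sigma>_def by (rule coeff_order_imp_has_order)
qed

end
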